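(* Let $k$ and $j$ be integers with $k>j\ge 0$ and let $C>0$, $\alpha>1$ be real numbers. Let $\mathcal{F}$ be a family of meromorphic functions in some domain $D\subseteq\mathbb{C}$ such that for each $f\in\mathcal{F}$ $$\frac{|f^{(k)}|}{1+|f^{(j)}|^\alpha}(z)\ge C \qquad \text{for all } z\in D.$$ Then $\mathcal{F}$ is quasi-normal in $D$. Moreover, if all functions in $\mathcal{F}$ are holomorphic in $D$, then $\mathcal{F}$ is quasi-normal of order at most $j-1$ in $D$ (for $j=0$ and $j=1$ this means that $\mathcal{F}$ is normal in $D$).
   Context: A domain is a nonempty connected open subset of $\mathbb{C}$. Here $f^{(0)}=f$. At a pole of $f$, the value of the quotient $\frac{|f^{(k)}|}{1+|f^{(j)}|^\alpha}$ is understood as its limit in $[0,\infty]$. A family $\mathcal{F}$ of meromorphic functions in $D$ is normal in $D$ if every sequence in $\mathcal{F}$ has a subsequence which converges locally uniformly in $D$ with respect to the spherical metric (the limit function is allowed to be identically $\infty$). A family $\mathcal{F}$ of meromorphic functions in $D$ is called quasi-normal in $D$ if from each sequence $\{f_n\}_n$ in $\mathcal{F}$ one can extract a subsequence which converges locally uniformly (with respect to the spherical metric, the limit $\infty$ being allowed) on $D\setminus E$, where the set $E\subseteq D$ (which may depend on $\{f_n\}_n$) has no accumulation point in $D$. If the exceptional set $E$ can always be chosen to have at most $q$ elements, $\mathcal{F}$ is said to be quasi-normal of order at most $q$; thus order at most $0$ means normal. For $j=0$, the phrase "quasi-normal of order at most $j-1=-1$" is by convention understood to mean normal. *)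

theory Defs
  imports "HOL-Complex_Analysis.Complex_Analysis"
begin

datatype riemann_sphere = Fin complex | Infty

fun chordal_dist :: "riemann_sphere \<Rightarrow> riemann_sphere \<Rightarrow> real" where
  "chordal_dist (Fin z) (Fin w) =
     norm (z - w) / (sqrt (1 + (norm z)\<^sup>2) * sqrt (1 + (norm w)\<^sup>2))"
| "chordal_dist (Fin z) Infty = 1 / sqrt (1 + (norm z)\<^sup>2)"
| "chordal_dist Infty (Fin w) = 1 / sqrt (1 + (norm w)\<^sup>2)"
| "chordal_dist Infty Infty = 0"

(* Great-circle distance on the sphere of diameter 1, i.e. the distance induced by the
   line element |dz| / (1 + |z|^2): chords of length c subtend arcs of length arcsin c. *)
definition spherical_dist :: "riemann_sphere \<Rightarrow> riemann_sphere \<Rightarrow> real" where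
  "spherical_dist p q = arcsin (chordal_dist p q)"

(* Meromorphic functions are complex-valued functions with f nicely_meromorphic_on D, so their value
   at a pole is the dummy 0; sphere_val restores the value infinity there. *)
definition sphere_val :: "(complex \<Rightarrow> complex) \<Rightarrow> complex \<Rightarrow> riemann_sphere" where
  "sphere_val f z = (if is_pole f z then Infty else Fin (f z))"

(* The limit g is an arbitrary sphere-valued function, in particular it may be constantly Infty.
   It need not be required to be meromorphic or constantly Infty on components of the open set U:
   that is automatic for locally uniform limits of meromorphic functions. *)
definition spherically_convergent_on ::
  "(nat \<Rightarrow> complex \<Rightarrow> complex) \<Rightarrow> complex set \<Rightarrow> bool" where
  "spherically_convergent_on f U \<longleftrightarrow>
     (\<exists>g :: complex \<Rightarrow> riemann_sphere. \<forall>z\<in>U. \<exists>r>0. ball z r \<subseteq> U \<and>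
        (\<forall>\<epsilon>>0. \<forall>\<^sub>F n in sequentially. \<forall>w\<in>ball z r.
           spherical_dist (sphere_val (f n) w) (g w) < \<epsilon>))"

definition normal_family_on :: "(complex \<Rightarrow> complex) set \<Rightarrow> complex set \<Rightarrow> bool" where
  "normal_family_on F D \<longleftrightarrow>
     (\<forall>f :: nat \<Rightarrow> complex \<Rightarrow> complex. range f \<subseteq> F \<longrightarrow>
        (\<exists>r :: nat \<Rightarrow> nat. strict_mono r \<and> spherically_convergent_on (f \<circ> r) D))"

definition quasi_normal_family_on :: "(complex \<Rightarrow> complex) set \<Rightarrow> complex set \<Rightarrow> bool" where
  "quasi_normal_family_on F D \<longleftrightarrow>
     (\<forall>f :: nat \<Rightarrow> complex \<Rightarrow> complex. range f \<subseteq> F \<longrightarrow>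
        (\<exists>(r :: nat \<Rightarrow> nat) E. strict_mono r \<and> E \<subseteq> D \<and> (\<forall>z\<in>D. \<not> z islimpt E) \<and>
           spherically_convergent_on (f \<circ> r) (D - E)))"

(* The order bound q is an integer so that the conventional value -1 can be expressed. *)
definition quasi_normal_family_of_order_le_on ::
  "int \<Rightarrow> (complex \<Rightarrow> complex) set \<Rightarrow> complex set \<Rightarrow> bool" where
  "quasi_normal_family_of_order_le_on q F D \<longleftrightarrow>
     (if q = -1 then normal_family_on F D
      else \<forall>f :: nat \<Rightarrow> complex \<Rightarrow> complex. range f \<subseteq> F \<longrightarrow>
        (\<exists>(r :: nat \<Rightarrow> nat) E. strict_mono r \<and> E \<subseteq> D \<and> finite E \<and> int (card E) \<le> q \<and>
           spherically_convergent_on (f \<circ> r) (D - E)))"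

lemma quasi_normal_family_of_order_le_on_0:
  "quasi_normal_family_of_order_le_on 0 F D \<longleftrightarrow> normal_family_on F D"
proof -
  have "(\<exists>E. E \<subseteq> D \<and> finite E \<and> int (card E) \<le> 0 \<and> spherically_convergent_on h (D - E)) \<longleftrightarrow>
        spherically_convergent_on h D" for h
    by (auto intro!: exI[of _ "{}"])
  then show ?thesis
    unfolding quasi_normal_family_of_order_le_on_def normal_family_on_def by simp
qed

definition deriv_quotient_fun ::
  "nat \<Rightarrow> nat \<Rightarrow> real \<Rightarrow> (complex \<Rightarrow> complex) \<Rightarrow> complex \<Rightarrow> ennreal" where
  "deriv_quotient_fun k j \<alpha> f z =
     ennreal (norm ((deriv ^^ k) f z) / (1 + norm ((deriv ^^ j) f z) powr \<alpha>))"

(* At a pole the iterated derivatives are meaningless, so the value is the limit in [0, infinity].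
   It exists: the quotient behaves like a constant times a real power of the distance to the pole. *)
definition deriv_quotient ::
  "nat \<Rightarrow> nat \<Rightarrow> real \<Rightarrow> (complex \<Rightarrow> complex) \<Rightarrow> complex \<Rightarrow> ennreal" where
  "deriv_quotient k j \<alpha> f z =
     (if is_pole f z then Lim (at z) (deriv_quotient_fun k j \<alpha> f)
      else deriv_quotient_fun k j \<alpha> f z)"

end

(* Put h = 1/f^(k) and G = f^(j)/f^(k). The inequality makes both holomorphic across the poles of f,
   with |h| <= 1/C and |G| <= c |h|^(1 - 1/alpha), while (G/h)^(k-j) = 1/h. Clearing denominators,
   h^(k-j) is linear in G and of degree k-j in h, so by the Cauchy estimates |h| on a disc is bounded
   by a power > 1 of its maximum on a larger disc. Iterating, h would vanish if it were too small;
   hence |h| exceeds, somewhere in each disc, a bound depending only on the disc. By Montel a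
   subsequence of h_n converges, and the limit is not identically 0. Off its discrete zero set Z,
   empty by Hurwitz if the f_n have no poles, the f_n are eventually holomorphic and f_n^(j) is
   locally bounded. Therefore f_n, divided by the size of its (j-1)-jet at a base point, converges;
   either f_n itself converges, or it tends to infinity off the at most j-1 zeros of a polynomial. *)
theory Submission
  imports Defs
begin

subsection \<open>A superlinear Cauchy estimate\<close>

text \<open>The functions f carry no upper bound, but 1/C bounds the reciprocals h from the outset;
  the danger, moved to h, is that h_n might tend to 0, which would leave no information about f_n.
  What rules this out is a gap in exponents. Put m = k - j and \<beta> = 1 - 1/\<alpha>. The m-th
  derivative of G/h has the form P/h^(m+1), and its equality with 1/h reads P = h^m. If |h| \<le> M
  on the larger disc, the Cauchy estimates bound P by a constant times M^(m + \<beta>), so |h| is at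
  most a constant times M^(1 + \<beta>/m) on the smaller one. The exponent exceeds 1 because
  \<alpha> > 1, and this surplus absorbs the growing constants of ever thinner annuli. A second
  obstacle is the lack of uniformity off Z: the index from which f_n is free of poles near a point
  depends on the point, so compactness must be argued locally. Finally, a bound on f_n^(j) leaves
  the polynomial part of degree below j uncontrolled; this part alone produces the further
  exceptional points, at most j - 1 in number.\<close>

primrec quot_num :: "(complex \<Rightarrow> complex) \<Rightarrow> (complex \<Rightarrow> complex) \<Rightarrow> nat \<Rightarrow> complex \<Rightarrow> complex" where
  "quot_num G h 0 = G"
| "quot_num G h (Suc l) =
     (\<lambda>z. h z * deriv (quot_num G h l) z - of_nat (Suc l) * deriv h z * quot_num G h l z)"

lemma holomorphic_quot_num:
  assumes "open S" "h holomorphic_on S" "G holomorphic_on S"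
  shows "quot_num G h l holomorphic_on S"
  using assms by (induction l) (auto intro!: holomorphic_intros)

text \<open>The recursion of \<open>quot_num\<close> is the quotient rule for
  \<open>quot_num G h l / h ^ Suc l\<close> with a common factor h^l cancelled. The numerator stays
  linear in \<open>G\<close> and homogeneous of degree \<open>l\<close> in \<open>h\<close>, which
  fixes the powers of \<open>N\<close> and \<open>M\<close> in the later bound
  \<open>norm_quot_num_le\<close>.\<close>

lemma higher_deriv_divide:
  assumes S: "open S" "h holomorphic_on S" "G holomorphic_on S"
    and "z \<in> S" "h z \<noteq> 0"
  shows "(deriv ^^ l) (\<lambda>w. G w / h w) z = quot_num G h l z / h z ^ Suc l"
  using assms(4,5)
proof (induction l arbitrary: z)
  case (Suc l)
  \<comment> \<open>The induction step differentiates the formula for \<open>l\<close>, so it must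
    hold near \<open>z\<close> and not only at \<open>z\<close>; \<open>U\<close> is an open set
    where it does.\<close>
  define U where "U = {w\<in>S. h w \<noteq> 0}"
  have "U = S \<inter> h -` (- {0})"
    by (auto simp: U_def)
  then have U: "open U" "z \<in> U"
    using continuous_open_preimage[OF holomorphic_on_imp_continuous_on[OF S(2)] S(1), of "- {0}"] Suc.prems
    by (auto simp: U_def)
  let ?P = "quot_num G h l"
  have P: "(?P has_field_derivative deriv ?P z) (at z)"
    using holomorphic_quot_num[OF S] S(1) Suc.prems(1) by (rule holomorphic_derivI)
  have h: "(h has_field_derivative deriv h z) (at z)"
    using S(2,1) Suc.prems(1) by (rule holomorphic_derivI)
  have hl: "((\<lambda>w. h w ^ Suc l) has_field_derivative of_nat (Suc l) * h z ^ l * deriv h z) (at z)"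
    using DERIV_power[OF h, of "Suc l"] by (simp add: algebra_simps)
  have "((\<lambda>w. ?P w / h w ^ Suc l) has_field_derivative
      (deriv ?P z * h z ^ Suc l - ?P z * (of_nat (Suc l) * h z ^ l * deriv h z)) / (h z ^ Suc l * h z ^ Suc l)) (at z)"
    using DERIV_divide[OF P hl] Suc.prems by simp
  moreover have "(deriv ?P z * h z ^ Suc l - ?P z * (of_nat (Suc l) * h z ^ l * deriv h z)) / (h z ^ Suc l * h z ^ Suc l)
      = quot_num G h (Suc l) z / h z ^ Suc (Suc l)"
  proof -
    have "deriv ?P z * h z ^ Suc l - ?P z * (of_nat (Suc l) * h z ^ l * deriv h z) = quot_num G h (Suc l) z * h z ^ l"
      by (simp add: algebra_simps)
    moreover have "h z ^ Suc l * h z ^ Suc l = h z ^ Suc (Suc l) * h z ^ l"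
      by (simp add: algebra_simps)
    ultimately show ?thesis using Suc.prems by simp
  qed
  ultimately have "((\<lambda>w. ?P w / h w ^ Suc l) has_field_derivative quot_num G h (Suc l) z / h z ^ Suc (Suc l)) (at z)"
    by simp
  then have "((deriv ^^ l) (\<lambda>w. G w / h w) has_field_derivative quot_num G h (Suc l) z / h z ^ Suc (Suc l)) (at z)"
    by (rule has_field_derivative_transform_within_open[OF _ U])
      (use Suc.IH in \<open>auto simp: U_def\<close>)
  then show ?case
    by (simp add: DERIV_imp_deriv)
qed simp

lemma norm_deriv_le_of_bound:
  assumes "open S" "f holomorphic_on S" "cball z \<delta> \<subseteq> S" "\<delta> > 0"
    and "\<And>w. w \<in> cball z \<delta> \<Longrightarrow> norm (f w) \<le> B"
  shows "norm (deriv f z) \<le> B / \<delta>"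
proof -
  have "norm ((deriv ^^ 1) f z) \<le> fact 1 * B / \<delta> ^ 1"
  proof (rule Cauchy_inequality)
    show "f holomorphic_on ball z \<delta>"
      using assms(2,3) ball_subset_cball holomorphic_on_subset by blast
    show "continuous_on (cball z \<delta>) f"
      using assms(2,3) continuous_on_subset holomorphic_on_imp_continuous_on by blast
  qed (use assms in \<open>auto simp: dist_norm\<close>)
  then show ?thesis by simp
qed

text \<open>Each differentiation is paid for with a ring of width \<delta>, so \<open>l\<close> of
  them shrink the radius by l \<delta>. In the induction step the two summands contribute 1 and l +
  1 times M B / \<delta>, where B is the previous bound; the factors l + 2 multiply up to the
  factorial.\<close>

lemma norm_quot_num_le:
  assumes S: "open S" "h holomorphic_on S" "G holomorphic_on S" "cball z0 r \<subseteq> S"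
    and bd: "\<And>z. z \<in> cball z0 r \<Longrightarrow> norm (h z) \<le> M" "\<And>z. z \<in> cball z0 r \<Longrightarrow> norm (G z) \<le> N"
    and \<delta>: "\<delta> > 0"
    and z: "z \<in> cball z0 (r - real l * \<delta>)"
  shows "norm (quot_num G h l z) \<le> fact (Suc l) * M ^ l * N / \<delta> ^ l"
  using z
proof (induction l arbitrary: z)
  case 0
  then show ?case using bd by simp
next
  case (Suc l)
  let ?P = "quot_num G h l" and ?B = "fact (Suc l) * M ^ l * N / \<delta> ^ l"
  have sub: "cball z \<delta> \<subseteq> cball z0 (r - real l * \<delta>)"
    using Suc.prems by (intro cball_subset_cball_iff[THEN iffD2]) (auto simp: algebra_simps dist_commute)
  have "cball z0 (r - real l * \<delta>) \<subseteq> cball z0 r"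
    using \<delta> by (intro subset_cball) simp
  with sub have sub': "cball z \<delta> \<subseteq> cball z0 r" by blast
  have "z \<in> cball z \<delta>" using \<delta> by simp
  then have hz: "norm (h z) \<le> M" and Pz: "norm (?P z) \<le> ?B"
    using sub sub' bd Suc.IH by blast+
  have dP: "norm (deriv ?P z) \<le> ?B / \<delta>"
    using sub sub' S Suc.IH \<delta>
    by (intro norm_deriv_le_of_bound[OF S(1) holomorphic_quot_num[OF S(1-3)]]) blast+
  have dh: "norm (deriv h z) \<le> M / \<delta>"
    using sub' S bd \<delta> by (intro norm_deriv_le_of_bound[OF S(1) S(2)]) blast+
  have M: "M \<ge> 0" and B: "?B \<ge> 0"
    using hz Pz norm_ge_zero order_trans by blast+
  have "norm (quot_num G h (Suc l) z)
      \<le> norm (h z * deriv ?P z) + norm (of_nat (Suc l) * deriv h z * ?P z)"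
    unfolding quot_num.simps by (rule norm_triangle_ineq4)
  also have "\<dots> = norm (h z) * norm (deriv ?P z) + real (Suc l) * norm (deriv h z) * norm (?P z)"
    by (simp only: norm_mult norm_of_nat)
  also have "\<dots> \<le> M * (?B / \<delta>) + real (Suc l) * (M / \<delta>) * ?B"
    using hz dP dh Pz M B \<delta>
    by (intro add_mono mult_mono mult_nonneg_nonneg) auto
  also have "\<dots> = real (Suc (Suc l)) * M * ?B / \<delta>"
    using \<delta> by (simp add: field_simps)
  also have "\<dots> = fact (Suc (Suc l)) * M ^ Suc l * N / \<delta> ^ Suc l"
    by (simp add: fact_Suc[of "Suc l"] mult_ac del: fact_Suc of_nat_Suc)
  finally show ?case .
qed

text \<open>The order of quantifiers is the point: \<epsilon> depends only on \<open>m\<close>,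
  \<open>R\<close>, \<beta> and \<open>c\<close>, so one \<epsilon> serves a whole sequence of
  solutions, and a single member that is uniformly small already vanishes on the half disc.\<close>

lemma small_solution_vanishes:
  fixes c \<beta> R :: real and m :: nat
  assumes "m > 0" "R > 0" "\<beta> > 0" "c \<ge> 0"
  obtains \<epsilon> where "\<epsilon> > 0"
    "\<And>S h G z0 z. \<lbrakk>open S; h holomorphic_on S; G holomorphic_on S; cball z0 R \<subseteq> S;
       \<And>z. z \<in> S \<Longrightarrow> norm (G z) \<le> c * norm (h z) powr \<beta>;
       \<And>z. \<lbrakk>z \<in> S; h z \<noteq> 0\<rbrakk> \<Longrightarrow> (deriv ^^ m) (\<lambda>w. G w / h w) z = 1 / h z;
       \<And>z. z \<in> cball z0 R \<Longrightarrow> norm (h z) \<le> \<epsilon>; z \<in> cball z0 (R / 2)\<rbrakk> \<Longrightarrow> h z = 0"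
proof -
  \<comment> \<open>With width \<delta> = R / (4 m 2^i), the Cauchy bound at stage i equals K 2^(m
    i) M^(m + \<beta>).\<close>
  define K where "K = fact (Suc m) * c * (4 * real m / R) ^ m"
  \<comment> \<open>Decay at rate \<mu> turns M^\<beta> into a multiple of \<mu>^(\<beta> i); this
    choice makes it cancel exactly the loss 2^(m i) from the shrinking widths.\<close>
  define \<mu> :: real where "\<mu> = 2 powr (- real m / \<beta>)"
  have \<mu>: "0 < \<mu>" "\<mu> < 1" 
    using assms by (auto simp: \<mu>_def powr_less_one)
  have \<mu>\<beta>: "\<mu> powr \<beta> * 2 ^ m = 1"
  proof -
    have "\<mu> powr \<beta> = 2 powr (- real m)"
      using assms by (simp add: \<mu>_def powr_powr)
    then show ?thesis by (simp add: powr_minus powr_realpow)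
  qed
  have K: "K \<ge> 0" using assms by (simp add: K_def)
  \<comment> \<open>Chosen so that K \<epsilon>^\<beta> \<le> \<mu>^m, the gain required at every
    stage; K + 1 avoids division by 0 when c = 0.\<close>
  define \<epsilon> where "\<epsilon> = (\<mu> ^ m / (K + 1)) powr (1 / \<beta>)"
  have \<epsilon>: "\<epsilon> > 0" using \<mu> K by (simp add: \<epsilon>_def)
  have \<epsilon>\<beta>: "\<epsilon> powr \<beta> = \<mu> ^ m / (K + 1)"
    using \<mu> K assms by (simp add: \<epsilon>_def powr_powr)
  have K\<epsilon>: "K * \<epsilon> powr \<beta> \<le> \<mu> ^ m"
    using K \<mu> by (simp add: \<epsilon>\<beta> field_simps)
  show ?thesis
  \<comment> \<open>With \<open>M r\<close> the maximum of \<open>|h|\<close> on the disc of radius \<open>r\<close>, the Cauchy estimates give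
      \<open>M r ^ m \<le> const * M r' ^ m * M r' powr \<beta> / (r' - r) ^ m\<close>; the exponent exceeds \<open>m\<close>, so along radii
      shrinking geometrically to \<open>R / 2\<close> a small \<open>M R\<close> forces geometric decay.\<close>
  proof (rule that[OF \<epsilon>])
    fix S :: "complex set" and h G :: "complex \<Rightarrow> complex" and z0 z :: complex
    assume S: "open S" "h holomorphic_on S" "G holomorphic_on S" "cball z0 R \<subseteq> S"
      and G: "\<And>z. z \<in> S \<Longrightarrow> norm (G z) \<le> c * norm (h z) powr \<beta>"
      and eq: "\<And>z. \<lbrakk>z \<in> S; h z \<noteq> 0\<rbrakk> \<Longrightarrow> (deriv ^^ m) (\<lambda>w. G w / h w) z = 1 / h z"
      and small: "\<And>z. z \<in> cball z0 R \<Longrightarrow> norm (h z) \<le> \<epsilon>"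
      and z: "z \<in> cball z0 (R / 2)"
    have decay: "norm (h z) \<le> \<epsilon> * \<mu> ^ i" if "z \<in> cball z0 (R / 2 + R / (2 * 2 ^ i))" for i z
      using that
    proof (induction i arbitrary: z)
      case 0
      then show ?case using small by simp
    next
      case (Suc i)
      define M where "M = \<epsilon> * \<mu> ^ i"
      define N where "N = c * M powr \<beta>"
      \<comment> \<open>Successive radii differ by R / (4 2^i), which is shared evenly among the
        \<open>m\<close> differentiations.\<close>
      define \<delta> where "\<delta> = R / (4 * real m * 2 ^ i)"
      define r where "r = R / 2 + R / (2 * 2 ^ i)"
      have M: "M > 0" and \<delta>: "\<delta> > 0"
        using \<epsilon> \<mu> assms by (auto simp: M_def \<delta>_def)
      have r: "r - real m * \<delta> = R / 2 + R / (2 * 2 ^ Suc i)"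
        using assms by (simp add: r_def \<delta>_def field_simps)
      have "R / (2 * 2 ^ i) \<le> R / (2 * 1)"
        using assms by (intro divide_left_mono) auto
      then have "r \<le> R" by (simp add: r_def)
      then have rS: "cball z0 r \<subseteq> S"
        using S(4) subset_cball by blast
      have hM: "norm (h w) \<le> M" if "w \<in> cball z0 r" for w
        using Suc.IH that by (simp add: M_def r_def)
      have GN: "norm (G w) \<le> N" if "w \<in> cball z0 r" for w
        unfolding N_def using that rS hM[OF that] assms
        by (intro order_trans[OF G] mult_left_mono powr_mono2) auto
      have "M powr \<beta> = \<epsilon> powr \<beta> * (\<mu> powr \<beta>) ^ i"
        using \<epsilon> \<mu> by (simp add: M_def powr_mult powr_powr mult_ac flip: powr_realpow)
      then have "fact (Suc m) * M ^ m * N / \<delta> ^ m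
          = M ^ m * (fact (Suc m) * c * \<epsilon> powr \<beta> * (\<mu> powr \<beta>) ^ i / \<delta> ^ m)"
        by (simp add: N_def mult_ac)
      also have "1 / \<delta> ^ m = (4 * real m / R) ^ m * (2 ^ m) ^ i"
        by (simp add: \<delta>_def power_divide power_mult_distrib power_commutes field_simps flip: power_mult)
      then have "fact (Suc m) * c * \<epsilon> powr \<beta> * (\<mu> powr \<beta>) ^ i / \<delta> ^ m
          = K * \<epsilon> powr \<beta> * (\<mu> powr \<beta> * 2 ^ m) ^ i"
        unfolding K_def power_mult_distrib[of "\<mu> powr \<beta>"] divide_inverse by (simp add: inverse_eq_divide mult_ac)
      also have "\<dots> = K * \<epsilon> powr \<beta>" by (simp add: \<mu>\<beta>)
      also have "M ^ m * (K * \<epsilon> powr \<beta>) \<le> M ^ m * \<mu> ^ m"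
        using K\<epsilon> M by (intro mult_left_mono) auto
      finally have bound: "fact (Suc m) * M ^ m * N / \<delta> ^ m \<le> (M * \<mu>) ^ m"
        by (simp add: power_mult_distrib)
      show ?case
      \<comment> \<open>At a zero of \<open>h\<close> the differential equation says nothing, but
        the bound is trivial.\<close>
      proof (cases "h z = 0")
        case True
        then show ?thesis using \<epsilon> \<mu> by simp
      next
        case False
        have zS: "z \<in> S"
        proof -
          have "R / 2 + R / (2 * 2 ^ Suc i) \<le> r"
            unfolding r[symmetric] using \<delta> by simp
          then show ?thesis
            using Suc.prems rS subset_cball by blast
        qed
        have "quot_num G h m z / h z ^ Suc m = 1 / h z"
          using higher_deriv_divide[OF S(1-3) zS False, of m] eq[OF zS False] by simp
        then have "quot_num G h m z = h z ^ m"
          using False by (simp add: field_simps)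
        moreover have "norm (quot_num G h m z) \<le> fact (Suc m) * M ^ m * N / \<delta> ^ m"
          using Suc.prems by (intro norm_quot_num_le[OF S(1-3) rS _ _ \<delta>]) (simp_all only: r hM GN)
        ultimately have "norm (h z) ^ m \<le> (M * \<mu>) ^ m"
          using bound by (simp add: norm_power)
        then have "norm (h z) \<le> M * \<mu>"
          using M \<mu> \<open>m > 0\<close> by (simp add: power_mono_iff)
        then show ?thesis by (simp add: M_def mult_ac)
      qed
    qed
    have "norm (h z) \<le> \<epsilon> * \<mu> ^ i" for i
    proof (rule decay)
      have "R / (2 * 2 ^ i) > 0" using assms by simp
      then show "z \<in> cball z0 (R / 2 + R / (2 * 2 ^ i))" using z by simp
    qed
    moreover have "(\<lambda>i. \<epsilon> * \<mu> ^ i) \<longlonglongrightarrow> \<epsilon> * 0"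
      using \<mu> by (intro tendsto_intros LIMSEQ_power_zero) auto
    ultimately have "norm (h z) \<le> \<epsilon> * 0"
      by (intro LIMSEQ_le_const) auto
    then show "h z = 0" by simp
  qed
qed

subsection \<open>Locally bounded sequences of holomorphic functions\<close>

text \<open>Radius, bound and starting index may all depend on the point. This is the form in which
  information arrives off the zeros of the limit of the reciprocals, where early members of the
  sequence may still have poles.\<close>

definition locally_bounded_seq_on :: "complex set \<Rightarrow> (nat \<Rightarrow> complex \<Rightarrow> complex) \<Rightarrow> bool" where
  "locally_bounded_seq_on S u \<longleftrightarrow> (\<forall>z\<in>S. \<exists>r>0. \<exists>B. \<forall>\<^sub>F n in sequentially.
     u n holomorphic_on ball z r \<and> (\<forall>w\<in>ball z r. norm (u n w) \<le> B))"

definition locally_holomorphic_seq_on :: "complex set \<Rightarrow> (nat \<Rightarrow> complex \<Rightarrow> complex) \<Rightarrow> bool" where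
  "locally_holomorphic_seq_on S u \<longleftrightarrow> (\<forall>z\<in>S. \<exists>r>0. \<forall>\<^sub>F n in sequentially. u n holomorphic_on ball z r)"

lemma locally_bounded_seq_onE_ball:
  assumes "open S" "locally_bounded_seq_on S u" "z \<in> S"
  obtains r B where "r > 0" "ball z r \<subseteq> S" "\<forall>\<^sub>F n in sequentially.
     u n holomorphic_on ball z r \<and> (\<forall>w\<in>ball z r. norm (u n w) \<le> B)"
proof -
  obtain r B where r: "r > 0" "\<forall>\<^sub>F n in sequentially.
     u n holomorphic_on ball z r \<and> (\<forall>w\<in>ball z r. norm (u n w) \<le> B)"
    using assms unfolding locally_bounded_seq_on_def by blast
  obtain r' where r': "r' > 0" "ball z r' \<subseteq> S"
    using assms open_contains_ball by metis
  show thesis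
  proof (rule that[of "min r r'" B])
    show "\<forall>\<^sub>F n in sequentially.
     u n holomorphic_on ball z (min r r') \<and> (\<forall>w\<in>ball z (min r r'). norm (u n w) \<le> B)"
      using r(2) by eventually_elim (auto elim: holomorphic_on_subset)
  qed (use r r' in auto)
qed

text \<open>Montel's theorem is applied on each ball of a countable cover, where one bound and one
  starting index suffice, and a diagonal subsequence handles all balls together.\<close>

lemma Montel_locally_bounded_seq:
  assumes S: "open S" and u: "locally_bounded_seq_on S u"
  obtains \<rho> g where "strict_mono (\<rho> :: nat \<Rightarrow> nat)" "g holomorphic_on S"
    "\<And>z. z \<in> S \<Longrightarrow> \<exists>r>0. ball z r \<subseteq> S \<and> (\<forall>\<^sub>F n in sequentially. u (\<rho> n) holomorphic_on ball z r) \<and>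
       uniform_limit (ball z r) (u \<circ> \<rho>) g sequentially"
proof (cases "S = {}")
  case True
  then show ?thesis using that[of id "\<lambda>_. 0"] by (auto simp: strict_mono_def)
next
  case False
  define Q where "Q z r B N \<longleftrightarrow> r > 0 \<and> ball z r \<subseteq> S \<and>
    (\<forall>n\<ge>N. u n holomorphic_on ball z r \<and> (\<forall>w\<in>ball z r. norm (u n w) \<le> B))" for z r B N
  have "\<exists>r B N. Q z r B N" if z: "z \<in> S" for z
  proof -
    obtain r B where "r > 0" "ball z r \<subseteq> S" "\<forall>\<^sub>F n in sequentially.
      u n holomorphic_on ball z r \<and> (\<forall>w\<in>ball z r. norm (u n w) \<le> B)"
      using locally_bounded_seq_onE_ball[OF S u z] by blast
    then show ?thesis
      unfolding Q_def eventually_sequentially by blast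
  qed
  then obtain r B N where Q: "\<And>z. z \<in> S \<Longrightarrow> Q z (r z) (B z) (N z)"
    by metis
  have r: "\<And>z. z \<in> S \<Longrightarrow> r z > 0" "\<And>z. z \<in> S \<Longrightarrow> ball z (r z) \<subseteq> S"
      "\<And>z n. z \<in> S \<Longrightarrow> n \<ge> N z \<Longrightarrow> u n holomorphic_on ball z (r z)"
      "\<And>z n w. z \<in> S \<Longrightarrow> n \<ge> N z \<Longrightarrow> w \<in> ball z (r z) \<Longrightarrow> norm (u n w) \<le> B z"
    using Q unfolding Q_def by blast+
  \<comment> \<open>Half radii: convergence is uniform only on compact subsets of a ball, such as
    the closed ball of half the radius, and these smaller balls must still cover
    \<open>S\<close>.\<close>
  obtain T where T: "T \<subseteq> (\<lambda>z. ball z (r z / 2)) ` S" "countable T"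
      "\<Union>T = \<Union>((\<lambda>z. ball z (r z / 2)) ` S)"
    by (rule Lindelof[of "(\<lambda>z. ball z (r z / 2)) ` S"]) auto
  obtain S' where S': "countable S'" "S' \<subseteq> S" "T = (\<lambda>z. ball z (r z / 2)) ` S'"
    using T(1,2) countable_subset_image[of T "\<lambda>z. ball z (r z / 2)" S] by blast
  have cover: "\<exists>t\<in>S'. z \<in> ball t (r t / 2)" if "z \<in> S" for z
  proof -
    have "z \<in> ball z (r z / 2)" using r(1)[OF that] by simp
    then have "z \<in> \<Union>T" using that T(3) by blast
    then show ?thesis using S'(3) by blast
  qed
  with False have "S' \<noteq> {}" by blast
  define t where "t = from_nat_into S'"
  have t: "t i \<in> S" for i
    using from_nat_into[OF \<open>S' \<noteq> {}\<close>, of i] S'(2) by (auto simp: t_def)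
  \<comment> \<open>The members before the starting index are replaced by 0, so that Montel's
    theorem meets a family bounded from its first member on; limits are unaffected.\<close>
  define v where "v i n = (if n \<ge> N (t i) then u n else (\<lambda>_. 0))" for i n
  define P where "P i \<kappa> \<longleftrightarrow> (\<exists>g. g holomorphic_on ball (t i) (r (t i)) \<and>
      uniform_limit (cball (t i) (r (t i) / 2)) (\<lambda>n. v i (\<kappa> n)) g sequentially)" for i and \<kappa> :: "nat \<Rightarrow> nat"
  obtain \<kappa> :: "nat \<Rightarrow> nat" where \<kappa>: "strict_mono \<kappa>" "\<And>i. P i (id \<circ> \<kappa>)"
  proof (rule subsequence_diagonalization_lemma[of P id])
    fix i and s :: "nat \<Rightarrow> nat"
    show "\<exists>k. strict_mono k \<and> P i (s \<circ> k)"
    proof -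
      let ?H = "{h. h holomorphic_on ball (t i) (r (t i)) \<and> (\<forall>w\<in>ball (t i) (r (t i)). norm (h w) \<le> \<bar>B (t i)\<bar>)}"
      have rng: "range (\<lambda>n. v i (s n)) \<subseteq> ?H"
        using r(3,4)[OF t] by (force simp: v_def intro: order_trans)
      obtain g k where "g holomorphic_on ball (t i) (r (t i))" "strict_mono (k :: nat \<Rightarrow> nat)"
        "\<And>K. \<lbrakk>compact K; K \<subseteq> ball (t i) (r (t i))\<rbrakk> \<Longrightarrow> uniform_limit K ((\<lambda>n. v i (s n)) \<circ> k) g sequentially"
      proof (rule Montel[of "ball (t i) (r (t i))" ?H "\<lambda>n. v i (s n)"])
        fix K :: "complex set" assume "K \<subseteq> ball (t i) (r (t i))"
        then show "\<exists>B. \<forall>h\<in>?H. \<forall>z\<in>K. norm (h z) \<le> B"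
          by (intro exI[of _ "\<bar>B (t i)\<bar>"]) auto
      qed (use rng in auto)
      moreover have "cball (t i) (r (t i) / 2) \<subseteq> ball (t i) (r (t i))"
        using r(1)[OF t, of i] by (simp add: cball_subset_ball_iff)
      ultimately show ?thesis
        unfolding P_def by (intro exI[of _ k]) (auto simp: o_def)
    qed
  next
    fix i M and s k1 k2 :: "nat \<Rightarrow> nat"
    \<comment> \<open>Convergence passes to \<open>k2\<close>, whose terms from \<open>M\<close> on
      occur in \<open>k1\<close> at no earlier position; the diagonal sequence stands in this
      relation to every stage.\<close>
    assume P1: "P i (s \<circ> k1)" and sub: "\<And>j. M \<le> j \<Longrightarrow> \<exists>j'. j \<le> j' \<and> k2 j = k1 j'"
    obtain g where g: "g holomorphic_on ball (t i) (r (t i))"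
        and lim: "uniform_limit (cball (t i) (r (t i) / 2)) (\<lambda>n. v i (s (k1 n))) g sequentially"
      using P1 by (auto simp: P_def)
    have "uniform_limit (cball (t i) (r (t i) / 2)) (\<lambda>n. v i (s (k2 n))) g sequentially"
    proof (rule uniform_limitI)
      fix e :: real assume "e > 0"
      then obtain L where L: "\<And>n w. n \<ge> L \<Longrightarrow> w \<in> cball (t i) (r (t i) / 2) \<Longrightarrow> dist (v i (s (k1 n)) w) (g w) < e"
        using uniform_limitD[OF lim \<open>e > 0\<close>] unfolding eventually_sequentially by blast
      show "\<forall>\<^sub>F n in sequentially. \<forall>w\<in>cball (t i) (r (t i) / 2). dist (v i (s (k2 n)) w) (g w) < e"
        using eventually_ge_at_top[of "max L M"]
      proof eventually_elim
        case (elim n)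
        then obtain j' where "n \<le> j'" "k2 n = k1 j'" using sub[of n] by auto
        then show ?case using L[of j'] elim by auto
      qed
    qed
    with g show "P i (s \<circ> k2)" by (auto simp: P_def)
  qed blast
  obtain g where g: "\<And>i. g i holomorphic_on ball (t i) (r (t i))"
    "\<And>i. uniform_limit (cball (t i) (r (t i) / 2)) (\<lambda>n. v i (\<kappa> n)) (g i) sequentially"
    using \<kappa>(2) unfolding P_def by simp metis
  have lim: "uniform_limit (cball (t i) (r (t i) / 2)) (u \<circ> \<kappa>) (g i) sequentially" for i
  proof -
    have "\<forall>\<^sub>F n in sequentially. \<kappa> n \<ge> N (t i)"
      using filterlim_subseq[OF \<kappa>(1)] by (simp add: filterlim_at_top)
    then have "\<forall>\<^sub>F n in sequentially. \<forall>w\<in>cball (t i) (r (t i) / 2). v i (\<kappa> n) w = (u \<circ> \<kappa>) n w"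
      by eventually_elim (simp add: v_def)
    then show ?thesis
      by (rule uniform_limit_cong[THEN iffD1, OF _ _ g(2)]) simp
  qed
  \<comment> \<open>A pointwise limit makes no reference to a ball, so the local limits
    \<open>g i\<close> agree on overlaps and glue to one function.\<close>
  define G where "G z = lim (\<lambda>n. u (\<kappa> n) z)" for z
  have Gg: "G z = g i z" if "z \<in> cball (t i) (r (t i) / 2)" for i z
    unfolding G_def using tendsto_uniform_limitI[OF lim that] by (intro limI) simp
  have near: "\<exists>i. z \<in> ball (t i) (r (t i) / 2)" if z: "z \<in> S" for z
  proof -
    obtain s where s: "s \<in> S'" "z \<in> ball s (r s / 2)" using cover[OF z] by blast
    obtain i where "t i = s"
      unfolding t_def using from_nat_into_surj[OF S'(1) s(1)] by blast
    with s show ?thesis by blast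
  qed
  show ?thesis
  proof (rule that[OF \<kappa>(1)])
    show "G holomorphic_on S"
    proof -
      have "G analytic_on {z}" if z: "z \<in> S" for z
      proof -
        obtain i where i: "z \<in> ball (t i) (r (t i) / 2)" using near z by blast
        have "g i holomorphic_on ball (t i) (r (t i) / 2)"
          by (rule holomorphic_on_subset[OF g(1)]) (use r(1)[OF t, of i] in auto)
        then have "G holomorphic_on ball (t i) (r (t i) / 2)"
        proof (rule holomorphic_transform)
          fix w assume "w \<in> ball (t i) (r (t i) / 2)"
          then have "w \<in> cball (t i) (r (t i) / 2)" by simp
          then show "g i w = G w" using Gg by simp
        qed
        then show ?thesis using i analytic_at open_ball by blast
      qed
      then show ?thesis
        using S analytic_on_analytic_at analytic_on_open by blast
    qed
  next
    fix z assume "z \<in> S"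
    then obtain i where i: "z \<in> ball (t i) (r (t i) / 2)" using near by blast
    then obtain e where e: "e > 0" "ball z e \<subseteq> ball (t i) (r (t i) / 2)"
      using open_contains_ball open_ball by metis
    have sub: "ball z e \<subseteq> cball (t i) (r (t i) / 2)" "ball z e \<subseteq> ball (t i) (r (t i))"
      using e(2) r(1)[OF t, of i] by (auto simp: subset_iff)
    have "uniform_limit (ball z e) (u \<circ> \<kappa>) (g i) sequentially"
      using lim sub(1) uniform_limit_on_subset by blast
    then have "uniform_limit (ball z e) (u \<circ> \<kappa>) G sequentially"
      by (rule uniform_limit_cong'[THEN iffD1, rotated -1]) (use Gg[of _ i] sub(1) in \<open>simp_all add: subset_iff\<close>)
    moreover have "\<forall>\<^sub>F n in sequentially. u (\<kappa> n) holomorphic_on ball z e"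
    proof -
      have "\<forall>\<^sub>F n in sequentially. \<kappa> n \<ge> N (t i)"
        using filterlim_subseq[OF \<kappa>(1)] by (simp add: filterlim_at_top)
      then show ?thesis
        by eventually_elim (use r(3)[OF t] sub(2) holomorphic_on_subset in blast)
    qed
    moreover have "ball z e \<subseteq> S" using sub(2) r(2)[OF t] by blast
    ultimately show "\<exists>r>0. ball z r \<subseteq> S \<and> (\<forall>\<^sub>F n in sequentially. u (\<kappa> n) holomorphic_on ball z r) \<and>
       uniform_limit (ball z r) (u \<circ> \<kappa>) G sequentially"
      using e(1) by blast
  qed
qed

text \<open>A bounded derivative bounds the oscillation of \<open>u n\<close> on small balls. Being
  eventually bounded at a point therefore spreads to all points of such a ball, and by connectedness
  from \<open>z0\<close> to all of \<open>S\<close>; the bound may grow on the way.\<close>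

lemma locally_bounded_seq_of_deriv:
  assumes S: "open S" "connected S" "z0 \<in> S"
    and u: "locally_holomorphic_seq_on S u"
    and du: "locally_bounded_seq_on S (\<lambda>n. deriv (u n))"
    and bd: "\<forall>\<^sub>F n in sequentially. norm (u n z0) \<le> B0"
  shows "locally_bounded_seq_on S u"
proof -
  have near: "\<exists>r>0. \<exists>B. ball z r \<subseteq> S \<and> (\<forall>\<^sub>F n in sequentially. u n holomorphic_on ball z r \<and>
      (\<forall>x\<in>ball z r. \<forall>y\<in>ball z r. norm (u n x - u n y) \<le> B))" if z: "z \<in> S" for z
  proof -
    obtain r1 B where r1: "r1 > 0" "ball z r1 \<subseteq> S" "\<forall>\<^sub>F n in sequentially. 
       deriv (u n) holomorphic_on ball z r1 \<and> (\<forall>w\<in>ball z r1. norm (deriv (u n) w) \<le> B)"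
      using locally_bounded_seq_onE_ball[OF S(1) du z] by blast
    obtain r2 where r2: "r2 > 0" "\<forall>\<^sub>F n in sequentially. u n holomorphic_on ball z r2"
      using u z by (auto simp: locally_holomorphic_seq_on_def)
    define r where "r = min r1 r2"
    have r: "r > 0" "ball z r \<subseteq> ball z r1" "ball z r \<subseteq> ball z r2" 
      using r1 r2 by (auto simp: r_def)
    have "\<forall>\<^sub>F n in sequentially. u n holomorphic_on ball z r \<and>
      (\<forall>x\<in>ball z r. \<forall>y\<in>ball z r. norm (u n x - u n y) \<le> \<bar>B\<bar> * (2 * r))"
      using r1(3) r2(2)
    proof eventually_elim
      case (elim n)
      have hol: "u n holomorphic_on ball z r"
        using elim(2) r(3) holomorphic_on_subset by blast
      have "norm (u n x - u n y) \<le> \<bar>B\<bar> * (2 * r)" if xy: "x \<in> ball z r" "y \<in> ball z r" for x y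
      proof -
        have "norm (u n x - u n y) \<le> \<bar>B\<bar> * norm (x - y)"
        proof (rule field_differentiable_bound[OF convex_ball])
          show "(u n has_field_derivative deriv (u n) w) (at w within ball z r)" if "w \<in> ball z r" for w
            using hol that by (meson holomorphic_derivI open_ball has_field_derivative_at_within)
          show "norm (deriv (u n) w) \<le> \<bar>B\<bar>" if "w \<in> ball z r" for w
            using elim(1) that r(2) by fastforce
        qed (use xy in auto)
        also have "norm (x - y) \<le> 2 * r"
          using xy dist_triangle2[of x y z] by (simp add: dist_norm norm_minus_commute)
        finally show ?thesis by (simp add: mult_left_mono)
      qed
      with hol show ?case by blast
    qed
    with r r1(2) show ?thesis by blast
  qed
  have all: "\<exists>B. \<forall>\<^sub>F n in sequentially. norm (u n z) \<le> B" if z: "z \<in> S" for z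
  proof (rule connected_induction_simple[OF S(2,3) z, where P = "\<lambda>z. \<exists>B. \<forall>\<^sub>F n in sequentially. norm (u n z) \<le> B"])
    show "\<exists>B. \<forall>\<^sub>F n in sequentially. norm (u n z0) \<le> B" using bd by blast
    fix a assume "a \<in> S"
    then obtain r B where r: "r > 0" "ball a r \<subseteq> S" "\<forall>\<^sub>F n in sequentially. u n holomorphic_on ball a r \<and>
      (\<forall>x\<in>ball a r. \<forall>y\<in>ball a r. norm (u n x - u n y) \<le> B)"
      using near by blast
    have "\<exists>B. \<forall>\<^sub>F n in sequentially. norm (u n y) \<le> B"
      if xy: "x \<in> ball a r" "y \<in> ball a r" and Bx: "\<forall>\<^sub>F n in sequentially. norm (u n x) \<le> Bx" for x y Bx
    proof
      show "\<forall>\<^sub>F n in sequentially. norm (u n y) \<le> B + Bx"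
        using Bx r(3)
      proof eventually_elim
        case (elim n)
        have "norm (u n y) \<le> norm (u n y - u n x) + norm (u n x)"
          by (metis diff_add_cancel norm_triangle_ineq)
        with elim xy show ?case by fastforce
      qed
    qed
    then show "\<exists>T. openin (top_of_set S) T \<and> a \<in> T \<and> (\<forall>x\<in>T. \<forall>y\<in>T.
        (\<exists>B. \<forall>\<^sub>F n in sequentially. norm (u n x) \<le> B) \<longrightarrow> (\<exists>B. \<forall>\<^sub>F n in sequentially. norm (u n y) \<le> B))"
      using r(1,2) by (intro exI[of _ "ball a r"]) (auto simp: openin_open_eq[OF S(1)])
  qed
  show ?thesis
    unfolding locally_bounded_seq_on_def
  proof
    fix z assume z: "z \<in> S"
    obtain r B where r: "r > 0" "\<forall>\<^sub>F n in sequentially. u n holomorphic_on ball z r \<and>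
      (\<forall>x\<in>ball z r. \<forall>y\<in>ball z r. norm (u n x - u n y) \<le> B)"
      using near z by blast
    obtain B' where B': "\<forall>\<^sub>F n in sequentially. norm (u n z) \<le> B'" using all z by blast
    have "\<forall>\<^sub>F n in sequentially. u n holomorphic_on ball z r \<and> (\<forall>w\<in>ball z r. norm (u n w) \<le> B + B')"
      using r(2) B'
    proof eventually_elim
      case (elim n)
      have "norm (u n w) \<le> B + B'" if "w \<in> ball z r" for w
      proof -
        have "norm (u n w) \<le> norm (u n w - u n z) + norm (u n z)"
          by (metis diff_add_cancel norm_triangle_ineq)
        moreover have "norm (u n w - u n z) \<le> B"
          using elim(1) that r(1) by simp
        ultimately show ?thesis using elim(2) by linarith
      qed
      with elim show ?case by blast
    qed
    with r(1) show "\<exists>r>0. \<exists>B. \<forall>\<^sub>F n in sequentially. u n holomorphic_on ball z r \<and> (\<forall>w\<in>ball z r. norm (u n w) \<le> B)"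
      by blast
  qed
qed

text \<open>Integration repeated \<open>j\<close> times: the induction passes to
  \<open>deriv (u n)\<close>, whose jet at \<open>z0\<close> is that of \<open>u n\<close> shifted
  by one.\<close>

lemma locally_bounded_seq_of_higher_deriv:
  assumes S: "open S" "connected S" "z0 \<in> S"
    and "locally_holomorphic_seq_on S u"
    and "locally_bounded_seq_on S (\<lambda>n. (deriv ^^ j) (u n))"
    and "\<And>i. i < j \<Longrightarrow> \<forall>\<^sub>F n in sequentially. norm ((deriv ^^ i) (u n) z0) \<le> B0"
  shows "locally_bounded_seq_on S u"
  using assms(4-6)
proof (induction j arbitrary: u)
  case (Suc j)
  show ?case
  proof (rule locally_bounded_seq_of_deriv[OF S Suc.prems(1)])
    show "locally_bounded_seq_on S (\<lambda>n. deriv (u n))"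
    proof (rule Suc.IH)
      show "locally_holomorphic_seq_on S (\<lambda>n. deriv (u n))"
        unfolding locally_holomorphic_seq_on_def
      proof
        fix z assume "z \<in> S"
        then obtain r where r: "r > 0" "\<forall>\<^sub>F n in sequentially. u n holomorphic_on ball z r"
          using Suc.prems(1) by (auto simp: locally_holomorphic_seq_on_def)
        then have "\<forall>\<^sub>F n in sequentially. deriv (u n) holomorphic_on ball z r"
          by (auto elim!: eventually_mono intro: holomorphic_deriv)
        with r show "\<exists>r>0. \<forall>\<^sub>F n in sequentially. deriv (u n) holomorphic_on ball z r" by blast
      qed
      show "locally_bounded_seq_on S (\<lambda>n. (deriv ^^ j) (deriv (u n)))"
        using Suc.prems(2) by (simp add: funpow_Suc_right del: funpow.simps)
      fix i assume "i < j"
      then show "\<forall>\<^sub>F n in sequentially. norm ((deriv ^^ i) (deriv (u n)) z0) \<le> B0"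
        using Suc.prems(3)[of "Suc i"] by (simp add: funpow_Suc_right del: funpow.simps)
    qed
    show "\<forall>\<^sub>F n in sequentially. norm (u n z0) \<le> B0"
      using Suc.prems(3)[of 0] by simp
  qed
qed simp

subsection \<open>Spherical convergence from a locally bounded derivative\<close>

text \<open>Continuity of \<open>arcsin\<close> at 0; it reduces all later estimates to the chordal
  distance.\<close>

lemma spherical_dist_lt:
  assumes "\<epsilon> > 0"
  obtains \<delta> where "\<delta> > 0" "\<And>p q. chordal_dist p q < \<delta> \<Longrightarrow> spherical_dist p q < \<epsilon>"
proof -
  have nonneg: "chordal_dist p q \<ge> 0" for p q
    by (cases p; cases q) auto
  have "isCont arcsin 0" by (rule isCont_arcsin) auto
  then obtain \<delta> where \<delta>: "\<delta> > 0" "\<And>x. \<bar>x\<bar> < \<delta> \<Longrightarrow> \<bar>arcsin x\<bar> < \<epsilon>"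
    using assms unfolding continuous_at_eps_delta dist_real_def by fastforce
  show thesis
  proof (rule that[OF \<delta>(1)])
    fix p q assume "chordal_dist p q < \<delta>"
    then have "\<bar>arcsin (chordal_dist p q)\<bar> < \<epsilon>"
      using \<delta>(2) nonneg by simp
    then show "spherical_dist p q < \<epsilon>"
      by (simp add: spherical_dist_def)
  qed
qed

lemma chordal_dist_Fin_le: "chordal_dist (Fin a) (Fin b) \<le> norm (a - b)"
proof -
  have "1 * 1 \<le> sqrt (1 + (norm a)\<^sup>2) * sqrt (1 + (norm b)\<^sup>2)"
    by (intro mult_mono) auto
  then have "norm (a - b) / (sqrt (1 + (norm a)\<^sup>2) * sqrt (1 + (norm b)\<^sup>2)) \<le> norm (a - b) / 1"
    by (intro divide_left_mono) auto
  then show ?thesis by simp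
qed

lemma chordal_dist_Infty_le:
  assumes "0 < K" "K \<le> norm a"
  shows "chordal_dist (Fin a) Infty \<le> 1 / K"
proof -
  have "norm a \<le> sqrt (1 + (norm a)\<^sup>2)"
    by (rule real_le_rsqrt) simp
  moreover have "0 < sqrt (1 + (norm a)\<^sup>2)"
    by (simp add: add_pos_nonneg)
  ultimately show ?thesis using assms by (auto intro!: divide_left_mono)
qed

lemma sphere_val_holomorphic:
  assumes "f holomorphic_on S" "open S" "w \<in> S"
  shows "sphere_val f w = Fin (f w)"
  using not_is_pole_holomorphic[OF assms(2,3,1)] by (simp add: sphere_val_def)

lemma spherically_convergent_onI_finite:
  assumes "\<And>z. z \<in> U \<Longrightarrow> \<exists>r>0. ball z r \<subseteq> U \<and> (\<forall>\<^sub>F n in sequentially. f n holomorphic_on ball z r) \<and>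
    uniform_limit (ball z r) f g sequentially"
  shows "spherically_convergent_on f U"
  unfolding spherically_convergent_on_def
proof (rule exI[of _ "\<lambda>w. Fin (g w)"], rule ballI)
  fix z assume "z \<in> U"
  then obtain r where r: "r > 0" "ball z r \<subseteq> U" "\<forall>\<^sub>F n in sequentially. f n holomorphic_on ball z r"
      "uniform_limit (ball z r) f g sequentially"
    using assms by blast
  have "\<forall>\<^sub>F n in sequentially. \<forall>w\<in>ball z r. spherical_dist (sphere_val (f n) w) (Fin (g w)) < \<epsilon>"
    if \<epsilon>: "\<epsilon> > 0" for \<epsilon>
  proof -
    obtain \<delta> where \<delta>: "\<delta> > 0" "\<And>p q. chordal_dist p q < \<delta> \<Longrightarrow> spherical_dist p q < \<epsilon>"
      using spherical_dist_lt[OF \<epsilon>] by blast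
    show ?thesis
      using r(3) uniform_limitD[OF r(4) \<delta>(1)]
    proof eventually_elim
      case (elim n)
      show ?case
      proof
        fix w assume w: "w \<in> ball z r"
        have "chordal_dist (Fin (f n w)) (Fin (g w)) < \<delta>"
          using chordal_dist_Fin_le[of "f n w" "g w"] elim(2) w by (fastforce simp: dist_norm)
        then show "spherical_dist (sphere_val (f n) w) (Fin (g w)) < \<epsilon>"
          using \<delta>(2) sphere_val_holomorphic[OF elim(1) open_ball w] by simp
      qed
    qed
  qed
  with r show "\<exists>r>0. ball z r \<subseteq> U \<and> (\<forall>\<epsilon>>0. \<forall>\<^sub>F n in sequentially. \<forall>w\<in>ball z r.
      spherical_dist (sphere_val (f n) w) (Fin (g w)) < \<epsilon>)" by blast
qed

lemma spherically_convergent_onI_infinite: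
  assumes "\<And>z. z \<in> U \<Longrightarrow> \<exists>r>0. ball z r \<subseteq> U \<and> (\<forall>\<^sub>F n in sequentially. f n holomorphic_on ball z r) \<and>
    (\<forall>K. \<forall>\<^sub>F n in sequentially. \<forall>w\<in>ball z r. K \<le> norm (f n w))"
  shows "spherically_convergent_on f U"
  unfolding spherically_convergent_on_def
proof (rule exI[of _ "\<lambda>w. Infty"], rule ballI)
  fix z assume "z \<in> U"
  then obtain r where r: "r > 0" "ball z r \<subseteq> U" "\<forall>\<^sub>F n in sequentially. f n holomorphic_on ball z r"
      "\<And>K. \<forall>\<^sub>F n in sequentially. \<forall>w\<in>ball z r. K \<le> norm (f n w)"
    using assms by blast
  have "\<forall>\<^sub>F n in sequentially. \<forall>w\<in>ball z r. spherical_dist (sphere_val (f n) w) Infty < \<epsilon>"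
    if \<epsilon>: "\<epsilon> > 0" for \<epsilon>
  proof -
    obtain \<delta> where \<delta>: "\<delta> > 0" "\<And>p q. chordal_dist p q < \<delta> \<Longrightarrow> spherical_dist p q < \<epsilon>"
      using spherical_dist_lt[OF \<epsilon>] by blast
    show ?thesis
      using r(3) r(4)[of "2 / \<delta>"]
    proof eventually_elim
      case (elim n)
      show ?case
      proof
        fix w assume w: "w \<in> ball z r"
        have "chordal_dist (Fin (f n w)) Infty \<le> 1 / (2 / \<delta>)"
          using elim(2) w \<delta>(1) by (intro chordal_dist_Infty_le) auto
        also have "\<dots> < \<delta>" using \<delta>(1) by simp
        finally show "spherical_dist (sphere_val (f n) w) Infty < \<epsilon>"
          using \<delta>(2) sphere_val_holomorphic[OF elim(1) open_ball w] by simp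
      qed
    qed
  qed
  with r show "\<exists>r>0. ball z r \<subseteq> U \<and> (\<forall>\<epsilon>>0. \<forall>\<^sub>F n in sequentially. \<forall>w\<in>ball z r.
      spherical_dist (sphere_val (f n) w) Infty < \<epsilon>)" by blast
qed

text \<open>All Taylor coefficients at \<open>z0\<close> from order \<open>j\<close> on vanish, so
  \<open>g\<close> is a polynomial of degree at most j - 1 near \<open>z0\<close>, and by the
  identity theorem on all of \<open>S\<close>. The derivative of order \<open>i\<close> supplies a
  nonzero coefficient.\<close>

lemma card_zeros_of_vanishing_higher_deriv:
  assumes S: "open S" "connected S" "z0 \<in> S" and g: "g holomorphic_on S"
    and zero: "\<And>z. z \<in> S \<Longrightarrow> (deriv ^^ j) g z = 0"
    and nz: "i < j" "(deriv ^^ i) g z0 \<noteq> 0"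
  shows "finite {w\<in>S. g w = 0}" "card {w\<in>S. g w = 0} \<le> j - 1"
proof -
  have zero': "(deriv ^^ n) g z0 = 0" if "n \<ge> j" for n
  proof -
    have "(deriv ^^ n) g = (deriv ^^ (n - j)) ((deriv ^^ j) g)"
      using that by (simp flip: funpow_add comp_apply[of "deriv ^^ (n - j)"])
    moreover have "(deriv ^^ (n - j)) ((deriv ^^ j) g) z0 = (deriv ^^ (n - j)) (\<lambda>_. 0) z0"
      by (rule higher_deriv_transform_within_open[OF _ _ S(1,3)])
        (use zero g S in \<open>auto intro!: holomorphic_intros\<close>)
    ultimately show ?thesis by simp
  qed
  define a where "a n = (deriv ^^ n) g z0 / fact n" for n
  have g_eq: "g w = (\<Sum>n\<le>j-1. a n * (w - z0) ^ n)" if w: "w \<in> S" for w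
  proof -
    obtain r where r: "r > 0" "ball z0 r \<subseteq> S" using S open_contains_ball by metis
    show ?thesis
    proof (rule analytic_continuation_open[of "ball z0 r" S g])
      show "(\<lambda>w. \<Sum>n\<le>j-1. a n * (w - z0) ^ n) holomorphic_on S"
        by (intro holomorphic_intros)
      fix x assume x: "x \<in> ball z0 r"
      have "(\<lambda>n. a n * (x - z0) ^ n) sums g x"
        unfolding a_def using g r(2) x by (intro holomorphic_power_series) (auto intro: holomorphic_on_subset)
      moreover have "(\<lambda>n. a n * (x - z0) ^ n) sums (\<Sum>n\<le>j-1. a n * (x - z0) ^ n)"
        by (rule sums_finite) (use zero' nz(1) in \<open>auto simp: a_def\<close>)
      ultimately show "g x = (\<Sum>n\<le>j-1. a n * (x - z0) ^ n)" by (rule sums_unique2)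
    qed (use S g r w in auto)
  qed
  define R where "R = {x. (\<Sum>n\<le>j-1. a n * x ^ n) = 0}"
  have "finite R \<and> card R \<le> j - 1"
    unfolding R_def by (rule polyfun_rootbound) (use nz in \<open>auto simp: a_def intro!: exI[of _ i]\<close>)
  moreover have "{w\<in>S. g w = 0} \<subseteq> (\<lambda>x. x + z0) ` R"
  proof
    fix w assume "w \<in> {w\<in>S. g w = 0}"
    then have "w - z0 \<in> R" using g_eq by (auto simp: R_def)
    then show "w \<in> (\<lambda>x. x + z0) ` R" by (intro image_eqI[of _ _ "w - z0"]) auto
  qed
  ultimately show "finite {w\<in>S. g w = 0}" "card {w\<in>S. g w = 0} \<le> j - 1"
    by (meson finite_subset finite_imageI card_image_le card_mono le_trans)+
qed

lemma spherically_convergent_subseq_of_higher_deriv_bounded: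
  assumes S: "open S" "connected S" "S \<noteq> {}"
    and hol: "locally_holomorphic_seq_on S f"
    and bd: "locally_bounded_seq_on S (\<lambda>n. (deriv ^^ j) (f n))"
  obtains \<rho> E where "strict_mono (\<rho> :: nat \<Rightarrow> nat)" "E \<subseteq> S" "finite E" "card E \<le> j - 1"
    "spherically_convergent_on (f \<circ> \<rho>) (S - E)"
proof -
  obtain z0 where z0: "z0 \<in> S" using S(3) by blast
  \<comment> \<open>Dividing \<open>f n\<close> by \<open>M n\<close> bounds its \<open>(j-1)\<close>-jet at \<open>z0\<close>. If \<open>M n\<close> tends to infinity, the limit of the
      quotients is a nonzero polynomial of degree less than \<open>j\<close>, and \<open>f n\<close> tends to infinity off its zeros.\<close>
  define M where "M n = 1 + (\<Sum>i<j. norm ((deriv ^^ i) (f n) z0))" for n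
  define c where "c n = 1 / M n" for n
  define u where "u n w = complex_of_real (c n) * f n w" for n w
  have M: "M n \<ge> 1" for n by (simp add: M_def sum_nonneg)
  have c: "0 < c n" "c n \<le> 1" for n using M[of n] by (auto simp: c_def)
  have f_eq: "f n = (\<lambda>w. complex_of_real (M n) * u n w)" for n
    using M[of n] by (auto simp: u_def c_def)
  have du: "(deriv ^^ i) (u n) w = complex_of_real (c n) * (deriv ^^ i) (f n) w"
    if "f n holomorphic_on ball z r" "w \<in> ball z r" for n i z r w
    unfolding u_def using that by (intro higher_deriv_cmult) auto
  have near: "\<exists>r>0. \<exists>B. ball z r \<subseteq> S \<and> (\<forall>\<^sub>F n in sequentially. f n holomorphic_on ball z r \<and>
      (\<forall>w\<in>ball z r. norm ((deriv ^^ j) (f n) w) \<le> B))" if z: "z \<in> S" for z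
  proof -
    obtain r1 B where r1: "r1 > 0" "ball z r1 \<subseteq> S" "\<forall>\<^sub>F n in sequentially. 
       (deriv ^^ j) (f n) holomorphic_on ball z r1 \<and> (\<forall>w\<in>ball z r1. norm ((deriv ^^ j) (f n) w) \<le> B)"
      using locally_bounded_seq_onE_ball[OF S(1) bd z] by blast
    obtain r2 where r2: "r2 > 0" "\<forall>\<^sub>F n in sequentially. f n holomorphic_on ball z r2"
      using hol z by (auto simp: locally_holomorphic_seq_on_def)
    have "\<forall>\<^sub>F n in sequentially. f n holomorphic_on ball z (min r1 r2) \<and>
      (\<forall>w\<in>ball z (min r1 r2). norm ((deriv ^^ j) (f n) w) \<le> B)"
      using r1(3) r2(2) by eventually_elim (auto elim: holomorphic_on_subset)
    then show ?thesis using r1 r2 by (intro exI[of _ "min r1 r2"]) auto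
  qed
  have "locally_bounded_seq_on S u"
  proof (rule locally_bounded_seq_of_higher_deriv[OF S(1,2) z0])
    show "locally_holomorphic_seq_on S u"
      unfolding locally_holomorphic_seq_on_def
    proof
      fix z assume "z \<in> S"
      then obtain r where r: "r > 0" "\<forall>\<^sub>F n in sequentially. f n holomorphic_on ball z r"
        using hol by (auto simp: locally_holomorphic_seq_on_def)
      from r(2) have "\<forall>\<^sub>F n in sequentially. u n holomorphic_on ball z r"
        by eventually_elim (auto simp: u_def[abs_def] intro!: holomorphic_intros)
      with r(1) show "\<exists>r>0. \<forall>\<^sub>F n in sequentially. u n holomorphic_on ball z r" by blast
    qed
    show "locally_bounded_seq_on S (\<lambda>n. (deriv ^^ j) (u n))"
      unfolding locally_bounded_seq_on_def
    proof
      fix z assume "z \<in> S"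
      then obtain r B where r: "r > 0" "\<forall>\<^sub>F n in sequentially. f n holomorphic_on ball z r \<and>
          (\<forall>w\<in>ball z r. norm ((deriv ^^ j) (f n) w) \<le> B)"
        using near by blast
      from r(2) have "\<forall>\<^sub>F n in sequentially. (deriv ^^ j) (u n) holomorphic_on ball z r \<and>
          (\<forall>w\<in>ball z r. norm ((deriv ^^ j) (u n) w) \<le> B)"
      proof eventually_elim
        case (elim n)
        have "u n holomorphic_on ball z r"
          using elim by (auto simp: u_def[abs_def] intro!: holomorphic_intros)
        then have "(deriv ^^ j) (u n) holomorphic_on ball z r"
          by (intro holomorphic_higher_deriv) auto
        moreover have "norm ((deriv ^^ j) (u n) w) \<le> B" if w: "w \<in> ball z r" for w
        proof -
          have "norm ((deriv ^^ j) (u n) w) = c n * norm ((deriv ^^ j) (f n) w)"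
            using du[OF conjunct1[OF elim] w] c[of n] by (simp add: norm_mult)
          also have "\<dots> \<le> 1 * norm ((deriv ^^ j) (f n) w)"
            using c by (intro mult_right_mono) auto
          finally show ?thesis using elim w by fastforce
        qed
        ultimately show ?case by blast
      qed
      with r(1) show "\<exists>r>0. \<exists>B. \<forall>\<^sub>F n in sequentially. (deriv ^^ j) (u n) holomorphic_on ball z r \<and>
          (\<forall>w\<in>ball z r. norm ((deriv ^^ j) (u n) w) \<le> B)" by blast
    qed
    fix i assume i: "i < j"
    obtain r where r: "r > 0" "\<forall>\<^sub>F n in sequentially. f n holomorphic_on ball z0 r"
      using hol z0 by (auto simp: locally_holomorphic_seq_on_def)
    from r(2) show "\<forall>\<^sub>F n in sequentially. norm ((deriv ^^ i) (u n) z0) \<le> 1"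
    proof eventually_elim
      case (elim n)
      have "norm ((deriv ^^ i) (f n) z0) \<le> (\<Sum>i<j. norm ((deriv ^^ i) (f n) z0))"
        using i by (intro member_le_sum) auto
      then have "norm ((deriv ^^ i) (f n) z0) \<le> M n" by (simp add: M_def)
      then have "c n * norm ((deriv ^^ i) (f n) z0) \<le> 1"
        using M[of n] by (simp add: c_def)
      then show ?case
        using du[OF elim, of z0 i] r(1) c[of n] by (simp add: norm_mult)
    qed
  qed
  from Montel_locally_bounded_seq[OF S(1) this]
  obtain \<rho>1 g where \<rho>1: "strict_mono (\<rho>1 :: nat \<Rightarrow> nat)" and g: "g holomorphic_on S"
    and lim1: "\<And>z. z \<in> S \<Longrightarrow> \<exists>r>0. ball z r \<subseteq> S \<and> (\<forall>\<^sub>F n in sequentially. u (\<rho>1 n) holomorphic_on ball z r) \<and>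
       uniform_limit (ball z r) (u \<circ> \<rho>1) g sequentially"
    by blast
  \<comment> \<open>The bounded reciprocals \<open>c\<close> are made to converge instead of
    \<open>M\<close>; a limit \<open>c0 = 0\<close> means that the jets blow up. For j = 0 the sum
    in \<open>M\<close> is empty, so \<open>c\<close> is constantly 1 and this case cannot
    occur.\<close>
  have "seq_compact {0..1::real}"
    using compact_Icc compact_imp_seq_compact by blast
  then obtain c0 \<rho>2 where c0: "c0 \<in> {0..1}" and \<rho>2: "strict_mono (\<rho>2 :: nat \<Rightarrow> nat)"
    and clim: "((\<lambda>n. c (\<rho>1 n)) \<circ> \<rho>2) \<longlonglongrightarrow> c0"
    by (rule seq_compactE[of "{0..1}" "\<lambda>n. c (\<rho>1 n)"]) (use c in \<open>auto simp: less_imp_le\<close>)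
  define \<rho> where "\<rho> = \<rho>1 \<circ> \<rho>2"
  have \<rho>: "strict_mono \<rho>" using \<rho>1 \<rho>2 by (simp add: \<rho>_def strict_mono_o)
  have clim: "(\<lambda>n. c (\<rho> n)) \<longlonglongrightarrow> c0" using clim by (simp add: \<rho>_def o_def)
  have lim: "\<exists>r>0. ball z r \<subseteq> S \<and> (\<forall>\<^sub>F n in sequentially. f (\<rho> n) holomorphic_on ball z r) \<and>
       (\<forall>\<^sub>F n in sequentially. u (\<rho> n) holomorphic_on ball z r) \<and>
       uniform_limit (ball z r) (\<lambda>n. u (\<rho> n)) g sequentially" if z: "z \<in> S" for z
  proof -
    obtain r where r: "r > 0" "ball z r \<subseteq> S" "\<forall>\<^sub>F n in sequentially. u (\<rho>1 n) holomorphic_on ball z r"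
       "uniform_limit (ball z r) (u \<circ> \<rho>1) g sequentially"
      using lim1[OF z] by blast
    have uh: "\<forall>\<^sub>F n in sequentially. u (\<rho> n) holomorphic_on ball z r"
      using eventually_subseq[OF \<rho>2 r(3)] by (simp add: \<rho>_def)
    then have "\<forall>\<^sub>F n in sequentially. f (\<rho> n) holomorphic_on ball z r"
      by eventually_elim (subst f_eq, auto intro!: holomorphic_intros)
    moreover have "uniform_limit (ball z r) (\<lambda>n. u (\<rho> n)) g sequentially"
      using eventually_subseq[OF \<rho>2 uniform_limitD[OF r(4)]] by (intro uniform_limitI) (simp add: \<rho>_def)
    ultimately show ?thesis using r uh by blast
  qed
  show thesis
  proof (cases "c0 = 0")
    case False
    have Mlim: "(\<lambda>n. complex_of_real (M (\<rho> n))) \<longlonglongrightarrow> complex_of_real (1 / c0)"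
      using tendsto_divide[OF tendsto_const[of 1] clim False] by (intro tendsto_of_real) (simp add: c_def)
    have "spherically_convergent_on (f \<circ> \<rho>) S"
    proof (rule spherically_convergent_onI_finite[where g = "\<lambda>w. complex_of_real (1 / c0) * g w"])
      fix z assume "z \<in> S"
      then obtain r where r: "r > 0" "ball z r \<subseteq> S" "\<forall>\<^sub>F n in sequentially. f (\<rho> n) holomorphic_on ball z r"
        "uniform_limit (ball z r) (\<lambda>n. u (\<rho> n)) g sequentially"
        using lim by blast
      \<comment> \<open>The product of uniform limits needs \<open>g\<close> bounded, which
        compactness of the closed disc of half the radius guarantees.\<close>
      have sub: "ball z (r / 2) \<subseteq> ball z r" "cball z (r / 2) \<subseteq> S"
        using r(1,2) by (auto simp: subset_iff)
      have "compact (g ` cball z (r / 2))"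
        using g sub(2) by (intro compact_continuous_image) (auto intro: holomorphic_on_imp_continuous_on holomorphic_on_subset)
      then have "bounded (g ` ball z (r / 2))"
        by (meson ball_subset_cball bounded_subset compact_imp_bounded image_mono)
      moreover have "uniform_limit (ball z (r / 2)) (\<lambda>n w. complex_of_real (M (\<rho> n))) (\<lambda>w. complex_of_real (1 / c0)) sequentially"
        using tendstoD[OF Mlim] by (intro uniform_limitI) (auto elim: eventually_mono)
      moreover have "uniform_limit (ball z (r / 2)) (\<lambda>n. u (\<rho> n)) g sequentially"
        using r(4) sub(1) by (rule uniform_limit_on_subset)
      ultimately have "uniform_limit (ball z (r / 2)) (\<lambda>n w. complex_of_real (M (\<rho> n)) * u (\<rho> n) w)
          (\<lambda>w. complex_of_real (1 / c0) * g w) sequentially"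
        using r(1) by (intro uniform_lim_mult) (auto simp: image_constant_conv)
      then have "uniform_limit (ball z (r / 2)) (f \<circ> \<rho>) (\<lambda>w. complex_of_real (1 / c0) * g w) sequentially"
        by (simp add: o_def f_eq[symmetric])
      moreover have "\<forall>\<^sub>F n in sequentially. (f \<circ> \<rho>) n holomorphic_on ball z (r / 2)"
        using r(3) by eventually_elim (use sub(1) in \<open>auto elim: holomorphic_on_subset\<close>)
      ultimately show "\<exists>r>0. ball z r \<subseteq> S \<and> (\<forall>\<^sub>F n in sequentially. (f \<circ> \<rho>) n holomorphic_on ball z r) \<and>
        uniform_limit (ball z r) (f \<circ> \<rho>) (\<lambda>w. complex_of_real (1 / c0) * g w) sequentially"
        using r(1) sub by (intro exI[of _ "r / 2"]) auto
    qed
    then show thesis using that[OF \<rho>, of "{}"] by simp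
  next
    case True
    define E where "E = {w\<in>S. g w = 0}"
    \<comment> \<open>The \<open>j\<close>-th derivatives of \<open>f (\<rho> n)\<close> are bounded
      near \<open>z\<close>, and those of \<open>u (\<rho> n)\<close> carry the extra factor
      \<open>c (\<rho> n)\<close>, which tends to 0.\<close>
    have gj: "(deriv ^^ j) g z = 0" if z: "z \<in> S" for z
    proof -
      obtain r where r: "r > 0" "\<forall>\<^sub>F n in sequentially. f (\<rho> n) holomorphic_on ball z r"
        "\<forall>\<^sub>F n in sequentially. u (\<rho> n) holomorphic_on ball z r"
        "uniform_limit (ball z r) (\<lambda>n. u (\<rho> n)) g sequentially"
        using lim[OF z] by blast
      obtain r' B where r': "r' > 0" "\<forall>\<^sub>F n in sequentially. f n holomorphic_on ball z r' \<and>
          (\<forall>w\<in>ball z r'. norm ((deriv ^^ j) (f n) w) \<le> B)"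
        using near[OF z] by blast
      have "(\<lambda>n. (deriv ^^ j) (u (\<rho> n)) z) \<longlonglongrightarrow> (deriv ^^ j) g z"
        using r by (intro higher_deriv_complex_uniform_limit[OF r(4,3)]) auto
      moreover have "(\<lambda>n. (deriv ^^ j) (u (\<rho> n)) z) \<longlonglongrightarrow> 0"
      proof (rule Lim_null_comparison)
        show "\<forall>\<^sub>F n in sequentially. norm ((deriv ^^ j) (u (\<rho> n)) z) \<le> c (\<rho> n) * B"
          using r(2) eventually_subseq[OF \<rho> r'(2)]
        proof eventually_elim
          case (elim n)
          then have "norm ((deriv ^^ j) (f (\<rho> n)) z) \<le> B" using r'(1) by simp
          then show ?case
            using du[OF elim(1), of z j] r(1) c[of "\<rho> n"] by (simp add: norm_mult mult_left_mono)
        qed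
        show "(\<lambda>n. c (\<rho> n) * B) \<longlonglongrightarrow> 0"
          using tendsto_mult_left_zero clim True by blast
      qed
      ultimately show ?thesis by (rule LIMSEQ_unique)
    qed
    \<comment> \<open>The normalization keeps the limit from vanishing: the jet of
      \<open>u n\<close> at \<open>z0\<close> has total size (M n - 1) / M n = 1 - c n.\<close>
    have "(\<Sum>i<j. norm ((deriv ^^ i) g z0)) = 1"
    proof -
      obtain r where r: "r > 0" "\<forall>\<^sub>F n in sequentially. f (\<rho> n) holomorphic_on ball z0 r"
        "\<forall>\<^sub>F n in sequentially. u (\<rho> n) holomorphic_on ball z0 r"
        "uniform_limit (ball z0 r) (\<lambda>n. u (\<rho> n)) g sequentially"
        using lim[OF z0] by blast
      have "(\<lambda>n. \<Sum>i<j. norm ((deriv ^^ i) (u (\<rho> n)) z0)) \<longlonglongrightarrow> (\<Sum>i<j. norm ((deriv ^^ i) g z0))"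
        using r by (intro tendsto_intros higher_deriv_complex_uniform_limit[OF r(4,3)]) auto
      moreover have "\<forall>\<^sub>F n in sequentially. (\<Sum>i<j. norm ((deriv ^^ i) (u (\<rho> n)) z0)) = 1 - c (\<rho> n)"
        using r(2)
      proof eventually_elim
        case (elim n)
        have "(\<Sum>i<j. norm ((deriv ^^ i) (u (\<rho> n)) z0)) = c (\<rho> n) * (\<Sum>i<j. norm ((deriv ^^ i) (f (\<rho> n)) z0))"
          using du[OF elim, of z0] r(1) c[of "\<rho> n"] by (simp add: norm_mult sum_distrib_left)
        also have "\<dots> = c (\<rho> n) * (M (\<rho> n) - 1)" by (simp add: M_def)
        also have "\<dots> = 1 - c (\<rho> n)" using M[of "\<rho> n"] by (simp add: c_def field_simps)
        finally show ?case .
      qed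
      ultimately have "(\<lambda>n. 1 - c (\<rho> n)) \<longlonglongrightarrow> (\<Sum>i<j. norm ((deriv ^^ i) g z0))"
        by (rule Lim_transform_eventually)
      moreover have "(\<lambda>n. 1 - c (\<rho> n)) \<longlonglongrightarrow> 1 - 0"
        using clim True by (intro tendsto_intros) auto
      ultimately show ?thesis using LIMSEQ_unique by fastforce
    qed
    then have "(\<Sum>i<j. norm ((deriv ^^ i) g z0)) \<noteq> 0" by simp
    then obtain i where "i \<in> {..<j}" "norm ((deriv ^^ i) g z0) \<noteq> 0"
      by (rule sum.not_neutral_contains_not_neutral)
    then have i: "i < j" "(deriv ^^ i) g z0 \<noteq> 0" by simp_all
    note E = card_zeros_of_vanishing_higher_deriv[OF S(1,2) z0 g gj i, folded E_def]
    have "spherically_convergent_on (f \<circ> \<rho>) (S - E)"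
    proof (rule spherically_convergent_onI_infinite)
      fix z assume z: "z \<in> S - E"
      then obtain r where r: "r > 0" "ball z r \<subseteq> S" "\<forall>\<^sub>F n in sequentially. f (\<rho> n) holomorphic_on ball z r"
        "uniform_limit (ball z r) (\<lambda>n. u (\<rho> n)) g sequentially"
        using lim by blast
      define d where "d = norm (g z) / 2"
      have d: "d > 0" using z by (simp add: d_def E_def)
      have "isCont g z"
        using g z S(1) by (metis DiffD1 continuous_on_eq_continuous_at holomorphic_on_imp_continuous_on)
      then obtain s where s: "s > 0" "\<And>w. dist w z < s \<Longrightarrow> dist (g w) (g z) < d"
        using d unfolding continuous_at_eps_delta by metis
      define t where "t = min r s"
      have t: "t > 0" "ball z t \<subseteq> ball z r" using r s by (auto simp: t_def)
      have gd: "norm (g w) > d" if "w \<in> ball z t" for w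
      proof -
        have "dist (g w) (g z) < d" using that s(2) by (auto simp: t_def dist_commute)
        then show ?thesis using norm_triangle_sub[of "g z" "g w"] by (simp add: d_def dist_norm norm_minus_commute)
      qed
      have "ball z t \<subseteq> S - E"
        using gd d t(2) r(2) by (fastforce simp: E_def)
      moreover have "\<forall>\<^sub>F n in sequentially. (f \<circ> \<rho>) n holomorphic_on ball z t"
        using r(3) by eventually_elim (use t(2) in \<open>auto elim: holomorphic_on_subset\<close>)
      \<comment> \<open>Eventually |u| \<ge> d/2 near \<open>z\<close>, and |f| = |u| / c, so c < d
        / (2 (|K| + 1)) forces |f| above |K| + 1.\<close>
      moreover have "\<forall>\<^sub>F n in sequentially. \<forall>w\<in>ball z t. K \<le> norm ((f \<circ> \<rho>) n w)" for K
      proof -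
        have "\<forall>\<^sub>F n in sequentially. c (\<rho> n) < d / (2 * (\<bar>K\<bar> + 1))"
          using clim True d by (intro order_tendstoD(2)) auto
        moreover have "\<forall>\<^sub>F n in sequentially. \<forall>w\<in>ball z r. dist (u (\<rho> n) w) (g w) < d / 2"
          using d by (intro uniform_limitD[OF r(4)]) simp
        ultimately show ?thesis
        proof eventually_elim
          case (elim n)
          show ?case
          proof
            fix w assume w: "w \<in> ball z t"
            have "dist (u (\<rho> n) w) (g w) < d / 2" using elim(2) w t(2) by blast
            then have ud: "norm (u (\<rho> n) w) \<ge> d / 2"
              using gd[OF w] norm_triangle_sub[of "g w" "u (\<rho> n) w"] by (simp add: dist_norm norm_minus_commute)
            have "1 / M (\<rho> n) < d / (2 * (\<bar>K\<bar> + 1))"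
              using elim(1) by (simp add: c_def)
            then have "\<bar>K\<bar> + 1 \<le> M (\<rho> n) * (d / 2)"
              using M[of "\<rho> n"] by (simp add: field_simps)
            also have "\<dots> \<le> M (\<rho> n) * norm (u (\<rho> n) w)"
              using ud M[of "\<rho> n"] by (intro mult_left_mono) auto
            also have "\<dots> = norm ((f \<circ> \<rho>) n w)"
              using M[of "\<rho> n"] by (simp add: f_eq[of "\<rho> n"] norm_mult)
            finally show "K \<le> norm ((f \<circ> \<rho>) n w)" by linarith
          qed
        qed
      qed
      ultimately show "\<exists>r>0. ball z r \<subseteq> S - E \<and> (\<forall>\<^sub>F n in sequentially. (f \<circ> \<rho>) n holomorphic_on ball z r) \<and>
        (\<forall>K. \<forall>\<^sub>F n in sequentially. \<forall>w\<in>ball z r. K \<le> norm ((f \<circ> \<rho>) n w))"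
        using t(1) by blast
    qed
    moreover have "E \<subseteq> S" by (auto simp: E_def)
    ultimately show thesis using that[OF \<rho>] E by blast
  qed
qed

subsection \<open>Quasi-normality\<close>

lemma is_pole_higher_deriv:
  assumes "f meromorphic_on {z}" "is_pole f z"
  shows "is_pole ((deriv ^^ n) f) z"
proof (induction n)
  case (Suc n)
  then show ?case
    using is_pole_deriv_iff[OF meromorphic_on_higher_deriv[OF assms(1)]] by simp
qed (use assms in simp)

lemma remove_sings_holomorphic:
  assumes "open D" "f meromorphic_on D" "\<And>z. z \<in> D \<Longrightarrow> \<exists>c. f \<midarrow>z\<rightarrow> c"
  shows "remove_sings f holomorphic_on D"
proof -
  have "remove_sings f analytic_on {z}" if z: "z \<in> D" for z
  proof -
    have "isolated_singularity_at f z"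
      using meromorphic_on_subset[OF assms(2), of "{z}"] z by (simp add: meromorphic_on_isolated_singularity)
    then show ?thesis
      using assms(3)[OF z] remove_sings_analytic_at by blast
  qed
  then show ?thesis
    using assms(1) analytic_on_analytic_at analytic_on_open by blast
qed

text \<open>Solving the inequality for \<open>a\<close> gives a \<le> (b / C)^(1/\<alpha>), and
  division by \<open>b\<close> leaves the exponent 1 - 1/\<alpha> on 1/b, positive as \<alpha> > 1.
  With a = |f^(j)| and b = |f^(k)| this compares G with h.\<close>

lemma quotient_le_powr:
  fixes a b C \<alpha> :: real
  assumes "C > 0" "\<alpha> > 1" "a \<ge> 0" "C * (1 + a powr \<alpha>) \<le> b"
  shows "a / b \<le> C powr (- 1 / \<alpha>) * (1 / b) powr (1 - 1 / \<alpha>)"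
proof -
  have "C * (1 + a powr \<alpha>) > 0"
    using assms by (intro mult_pos_pos add_pos_nonneg) auto
  then have b: "b > 0" using assms by linarith
  have "C * a powr \<alpha> \<le> b" using assms by (simp add: algebra_simps)
  then have "a powr \<alpha> \<le> b / C" using assms by (simp add: field_simps)
  then have "(a powr \<alpha>) powr (1 / \<alpha>) \<le> (b / C) powr (1 / \<alpha>)"
    using assms by (intro powr_mono2) auto
  then have "a \<le> (b / C) powr (1 / \<alpha>)"
    using assms by (simp add: powr_powr)
  also have "\<dots> = C powr (- 1 / \<alpha>) * b powr (1 / \<alpha>)"
    using assms b by (simp add: powr_divide powr_minus_divide)
  finally have "a / b \<le> C powr (- 1 / \<alpha>) * (b powr (1 / \<alpha>) / b)"
    using b by (simp add: divide_right_mono)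
  also have "b powr (1 / \<alpha>) / b = (1 / b) powr (1 - 1 / \<alpha>)"
    using b by (simp add: powr_diff powr_divide)
  finally show ?thesis .
qed

text \<open>Off the poles |f^(k)| \<ge> C, so \<open>p\<close> and \<open>q\<close> are analytic
  there. At a pole of \<open>f\<close> the derivative f^(k) has a pole too, so \<open>p\<close>
  tends to 0 and forces \<open>q\<close> to do the same. Both singularities are removable, and in
  \<open>D\<close> the extension \<open>h\<close> vanishes at the poles of \<open>f\<close> and
  nowhere else.\<close>

lemma reciprocal_higher_deriv_extension:
  fixes C \<alpha> :: real and f :: "complex \<Rightarrow> complex"
  assumes D: "open D" and f: "f nicely_meromorphic_on D" and "j < k" "C > 0" "\<alpha> > 1"
    and ineq: "\<And>z. z \<in> D \<Longrightarrow> \<not> is_pole f z \<Longrightarrow>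
      C * (1 + norm ((deriv ^^ j) f z) powr \<alpha>) \<le> norm ((deriv ^^ k) f z)"
  shows "\<exists>h G. h holomorphic_on D \<and> G holomorphic_on D \<and>
    (\<forall>z\<in>D. if is_pole f z then h z = 0 else h z \<noteq> 0 \<and> (deriv ^^ k) f z = 1 / h z) \<and>
    (\<forall>z\<in>D. norm (h z) \<le> 1 / C) \<and>
    (\<forall>z\<in>D. norm (G z) \<le> C powr (- 1 / \<alpha>) * norm (h z) powr (1 - 1 / \<alpha>)) \<and>
    (\<forall>z\<in>D. h z \<noteq> 0 \<longrightarrow> (deriv ^^ (k - j)) (\<lambda>w. G w / h w) z = 1 / h z)"
proof -
  define p where "p z = 1 / (deriv ^^ k) f z" for z
  define q where "q z = (deriv ^^ j) f z / (deriv ^^ k) f z" for z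
  have mero: "f meromorphic_on D" using f by (simp add: nicely_meromorphic_on_def)
  have mero': "(deriv ^^ n) f meromorphic_on D" for n
    using mero by (rule meromorphic_on_higher_deriv)
  have pq_mero: "p meromorphic_on D" "q meromorphic_on D"
    unfolding p_def q_def using mero' by (auto intro!: meromorphic_intros mero)
  have ana: "f analytic_on {z}" if "z \<in> D" "\<not> is_pole f z" for z
    using nicely_meromorphic_on_imp_analytic_at[OF f] that by blast
  have lower: "C \<le> norm ((deriv ^^ k) f z)" if "z \<in> D" "\<not> is_pole f z" for z
  proof -
    have "C * 1 \<le> C * (1 + norm ((deriv ^^ j) f z) powr \<alpha>)"
      using \<open>C > 0\<close> by (intro mult_left_mono) auto
    with ineq[OF that] show ?thesis by linarith
  qed
  have pq_ana: "p analytic_on {z}" "q analytic_on {z}" if "z \<in> D" "\<not> is_pole f z" for z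
    unfolding p_def q_def using ana[OF that] lower[OF that] \<open>C > 0\<close>
    by (auto intro!: analytic_intros)
  have q_le: "norm (q z) \<le> C powr (- 1 / \<alpha>) * norm (p z) powr (1 - 1 / \<alpha>)"
    if "z \<in> D" "\<not> is_pole f z" for z
    using quotient_le_powr[OF \<open>C > 0\<close> \<open>\<alpha> > 1\<close> norm_ge_zero ineq[OF that]]
    by (simp add: p_def q_def norm_divide)
  have p0: "p \<midarrow>z\<rightarrow> 0" if "z \<in> D" "is_pole f z" for z
  proof -
    have "is_pole ((deriv ^^ k) f) z"
      using meromorphic_on_subset[OF mero, of "{z}"] that by (simp add: is_pole_higher_deriv)
    then show ?thesis
      unfolding p_def is_pole_def by (intro tendsto_divide_0[OF tendsto_const])
  qed
  \<comment> \<open>Pole orders are not compared. Poles are isolated, so the bound of |q| by a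
    positive power of |p| holds in a punctured neighbourhood.\<close>
  have q0: "q \<midarrow>z\<rightarrow> 0" if z: "z \<in> D" "is_pole f z" for z
  proof (rule Lim_null_comparison)
    have "isolated_singularity_at f z"
      using meromorphic_on_subset[OF mero, of "{z}"] z by (simp add: meromorphic_on_isolated_singularity)
    then have "\<forall>\<^sub>F w in at z. \<not> is_pole f w" by (rule eventually_not_pole)
    moreover have "\<forall>\<^sub>F w in at z. w \<in> D"
      using D z(1) by (rule eventually_at_in_open')
    ultimately show "\<forall>\<^sub>F w in at z. norm (q w) \<le> C powr (- 1 / \<alpha>) * norm (p w) powr (1 - 1 / \<alpha>)"
      by eventually_elim (use q_le in blast)
    have "((\<lambda>w. norm (p w) powr (1 - 1 / \<alpha>)) \<longlongrightarrow> 0) (at z)"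
      using \<open>\<alpha> > 1\<close>
      by (intro tendsto_zero_powrI[OF tendsto_norm_zero[OF p0[OF z]] tendsto_const]) auto
    then show "((\<lambda>w. C powr (- 1 / \<alpha>) * norm (p w) powr (1 - 1 / \<alpha>)) \<longlongrightarrow> 0) (at z)"
      by (rule tendsto_mult_right_zero)
  qed
  define h where "h = remove_sings p"
  define G where "G = remove_sings q"
  have lim_ex: "\<exists>c. p \<midarrow>z\<rightarrow> c" "\<exists>c. q \<midarrow>z\<rightarrow> c" if "z \<in> D" for z
    using p0[OF that] q0[OF that] pq_ana[OF that] analytic_at_imp_isCont isContD by blast+
  have hol: "h holomorphic_on D" "G holomorphic_on D"
    unfolding h_def G_def using lim_ex by (auto intro!: remove_sings_holomorphic D pq_mero)
  have pole: "h z = 0" "G z = 0" if "z \<in> D" "is_pole f z" for z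
    unfolding h_def G_def using p0[OF that] q0[OF that] by (auto intro!: remove_sings_eqI)
  have nonpole: "h z = p z" "G z = q z" if "z \<in> D" "\<not> is_pole f z" for z
    unfolding h_def G_def using pq_ana[OF that] by auto
  have nz: "(deriv ^^ k) f z \<noteq> 0" if "z \<in> D" "\<not> is_pole f z" for z
    using lower[OF that] \<open>C > 0\<close> by auto
  \<comment> \<open>Where \<open>h\<close> does not vanish there is no pole, and G / h is
    f^(j).\<close>
  have dG: "(deriv ^^ (k - j)) (\<lambda>w. G w / h w) z = 1 / h z" if z: "z \<in> D" "h z \<noteq> 0" for z
  proof -
    define U where "U = {w\<in>D. h w \<noteq> 0}"
    have "U = D \<inter> h -` (- {0})" by (auto simp: U_def)
    then have U: "open U" "z \<in> U"
      using continuous_open_preimage[OF holomorphic_on_imp_continuous_on[OF hol(1)] D, of "- {0}"] z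
      by (auto simp: U_def)
    have np: "w \<in> D" "\<not> is_pole f w" if "w \<in> U" for w
      using that pole by (auto simp: U_def)
    have "f analytic_on U"
      using ana np analytic_on_analytic_at by blast
    then have "f holomorphic_on U"
      by (rule analytic_imp_holomorphic)
    have "(deriv ^^ (k - j)) (\<lambda>w. G w / h w) z = (deriv ^^ (k - j)) ((deriv ^^ j) f) z"
    proof (rule higher_deriv_transform_within_open[OF _ _ U])
      show "(\<lambda>w. G w / h w) holomorphic_on U"
        using hol by (auto intro!: holomorphic_intros elim: holomorphic_on_subset simp: U_def)
      show "(deriv ^^ j) f holomorphic_on U"
        using \<open>f holomorphic_on U\<close> U(1) by (rule holomorphic_higher_deriv)
      fix w assume "w \<in> U"
      then show "G w / h w = (deriv ^^ j) f w"
        using np nonpole nz by (simp add: p_def q_def)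
    qed
    also have "\<dots> = (deriv ^^ k) f z"
      using \<open>j < k\<close> by (simp flip: funpow_add comp_apply[of "deriv ^^ (k - j)"])
    also have "\<dots> = 1 / h z"
      using np[OF U(2)] nonpole by (simp add: p_def)
    finally show ?thesis .
  qed
  have h_le: "norm (h z) \<le> 1 / C" if z: "z \<in> D" for z
  proof (cases "is_pole f z")
    case False
    then show ?thesis
      using lower[OF z] nonpole[OF z] \<open>C > 0\<close> by (simp add: p_def norm_divide frac_le)
  qed (use pole z \<open>C > 0\<close> in simp)
  have G_le: "norm (G z) \<le> C powr (- 1 / \<alpha>) * norm (h z) powr (1 - 1 / \<alpha>)" if z: "z \<in> D" for z
    using q_le[OF z] nonpole[OF z] pole[OF z] by (cases "is_pole f z") auto
  show ?thesis
    using hol pole nonpole nz h_le G_le dG by (intro exI[of _ h] exI[of _ G]) (auto simp: p_def)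
qed

text \<open>The two exceptional sets have different origins and are kept apart: \<open>Z\<close>,
  the zeros of the limit of the reciprocals, may be infinite but disappears for holomorphic
  functions; \<open>E\<close>, coming from the zeros of the limit polynomial of the rescaled
  functions, is counted by \<open>j\<close>.\<close>

lemma quasi_normal_subsequence:
  fixes C \<alpha> :: real and f :: "nat \<Rightarrow> complex \<Rightarrow> complex"
  assumes D: "open D" "connected D" "D \<noteq> {}"
    and f: "\<And>n. f n nicely_meromorphic_on D" and par: "j < k" "C > 0" "\<alpha> > 1"
    and ineq: "\<And>n z. z \<in> D \<Longrightarrow> \<not> is_pole (f n) z \<Longrightarrow>
      C * (1 + norm ((deriv ^^ j) (f n) z) powr \<alpha>) \<le> norm ((deriv ^^ k) (f n) z)"
  obtains \<rho> Z E where "strict_mono (\<rho> :: nat \<Rightarrow> nat)"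
    "Z \<subseteq> D" "\<And>z. z \<in> D \<Longrightarrow> \<not> z islimpt Z" "(\<And>n. f n holomorphic_on D) \<Longrightarrow> Z = {}"
    "E \<subseteq> D" "finite E" "card E \<le> j - 1" "spherically_convergent_on (f \<circ> \<rho>) (D - (Z \<union> E))"
proof -
  define \<beta> where "\<beta> = 1 - 1 / \<alpha>"
  define c where "c = C powr (- 1 / \<alpha>)"
  have \<beta>: "\<beta> > 0" and c: "c \<ge> 0" using par by (auto simp: \<beta>_def c_def)
  define P where "P n h G \<longleftrightarrow> h holomorphic_on D \<and> G holomorphic_on D \<and>
    (\<forall>z\<in>D. if is_pole (f n) z then h z = 0 else h z \<noteq> 0 \<and> (deriv ^^ k) (f n) z = 1 / h z) \<and>
    (\<forall>z\<in>D. norm (h z) \<le> 1 / C) \<and>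
    (\<forall>z\<in>D. norm (G z) \<le> c * norm (h z) powr \<beta>) \<and>
    (\<forall>z\<in>D. h z \<noteq> 0 \<longrightarrow> (deriv ^^ (k - j)) (\<lambda>w. G w / h w) z = 1 / h z)" for n h G
  have "\<exists>h G. P n h G" for n
    unfolding P_def c_def \<beta>_def
    using reciprocal_higher_deriv_extension[OF D(1) f par ineq] by blast
  then obtain h G where P: "\<And>n. P n (h n) (G n)" by metis
  have h: "h n holomorphic_on D" and G: "G n holomorphic_on D" for n
    using P by (simp_all add: P_def)
  have pole: "h n z = 0" if "z \<in> D" "is_pole (f n) z" for n z
    using P that by (simp add: P_def)
  have nonpole: "h n z \<noteq> 0" "(deriv ^^ k) (f n) z = 1 / h n z" if "z \<in> D" "\<not> is_pole (f n) z" for n z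
    using P[of n] that by (auto simp: P_def)
  have h_le: "norm (h n z) \<le> 1 / C" if "z \<in> D" for n z
    using P that by (simp add: P_def)
  obtain \<sigma> g where \<sigma>: "strict_mono (\<sigma> :: nat \<Rightarrow> nat)" and g: "g holomorphic_on D"
    and lim: "\<And>K. \<lbrakk>compact K; K \<subseteq> D\<rbrakk> \<Longrightarrow> uniform_limit K (h \<circ> \<sigma>) g sequentially"
  proof (rule Montel[OF D(1), of "{\<phi>. \<phi> holomorphic_on D \<and> (\<forall>z\<in>D. norm (\<phi> z) \<le> 1 / C)}" h])
    fix K assume "K \<subseteq> D"
    then show "\<exists>B. \<forall>\<phi>\<in>{\<phi>. \<phi> holomorphic_on D \<and> (\<forall>z\<in>D. norm (\<phi> z) \<le> 1 / C)}. \<forall>z\<in>K. norm (\<phi> z) \<le> B"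
      by (intro exI[of _ "1 / C"]) auto
  qed (use h h_le in auto)
  obtain z1 where z1: "z1 \<in> D" "g z1 \<noteq> 0"
  proof -
    obtain z0 where z0: "z0 \<in> D" using D(3) by blast
    obtain R where R: "R > 0" "cball z0 R \<subseteq> D" using D(1) z0 open_contains_cball by metis
    have "k - j > 0" using par(1) by simp
    from small_solution_vanishes[OF this R(1) \<beta> c]
    obtain \<epsilon> where \<epsilon>: "\<epsilon> > 0" and van: "\<And>S h G z0 z. \<lbrakk>open S; h holomorphic_on S; G holomorphic_on S; cball z0 R \<subseteq> S;
       \<And>z. z \<in> S \<Longrightarrow> norm (G z) \<le> c * norm (h z) powr \<beta>;
       \<And>z. \<lbrakk>z \<in> S; h z \<noteq> 0\<rbrakk> \<Longrightarrow> (deriv ^^ (k - j)) (\<lambda>w. G w / h w) z = 1 / h z;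
       \<And>z. z \<in> cball z0 R \<Longrightarrow> norm (h z) \<le> \<epsilon>; z \<in> cball z0 (R / 2)\<rbrakk> \<Longrightarrow> h z = 0"
      by blast
    \<comment> \<open>If \<open>g\<close> vanished on the disc, a single late
      \<open>h (\<sigma> n)\<close> would be small enough to be 0 on the half disc. But it vanishes
      only at poles of \<open>f (\<sigma> n)\<close>, and these are isolated.\<close>
    have "\<exists>z\<in>cball z0 R. g z \<noteq> 0"
    proof (rule ccontr)
      assume "\<not> ?thesis"
      then have g0: "\<And>z. z \<in> cball z0 R \<Longrightarrow> g z = 0" by blast
      obtain n where "\<forall>z\<in>cball z0 R. dist ((h \<circ> \<sigma>) n z) (g z) < \<epsilon>"
        using eventually_happens[OF uniform_limitD[OF lim[OF compact_cball R(2)] \<epsilon>]]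
        by (metis trivial_limit_sequentially)
      then have n: "dist (h (\<sigma> n) z) (g z) < \<epsilon>" if "z \<in> cball z0 R" for z
        using that by (metis comp_apply)
      have h0: "h (\<sigma> n) z = 0" if "z \<in> cball z0 (R / 2)" for z
      proof (rule van[OF D(1) h G R(2) _ _ _ that])
        show "norm (G (\<sigma> n) z) \<le> c * norm (h (\<sigma> n) z) powr \<beta>" if "z \<in> D" for z
          using P that by (simp add: P_def)
        show "(deriv ^^ (k - j)) (\<lambda>w. G (\<sigma> n) w / h (\<sigma> n) w) z = 1 / h (\<sigma> n) z"
          if "z \<in> D" "h (\<sigma> n) z \<noteq> 0" for z
          using P that by (simp add: P_def)
        show "norm (h (\<sigma> n) z) \<le> \<epsilon>" if "z \<in> cball z0 R" for z
          using n[OF that] g0[OF that] by simp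
      qed
      have "isolated_singularity_at (f (\<sigma> n)) z0"
        using f[of "\<sigma> n"] z0 meromorphic_on_subset[of "f (\<sigma> n)" D "{z0}"]
        by (simp add: nicely_meromorphic_on_def meromorphic_on_isolated_singularity)
      then have "\<forall>\<^sub>F w in at z0. \<not> is_pole (f (\<sigma> n)) w" by (rule eventually_not_pole)
      moreover have "\<forall>\<^sub>F w in at z0. w \<in> ball z0 (R / 2)"
        using R(1) by (intro eventually_at_in_open') auto
      ultimately have "\<forall>\<^sub>F w in at z0. False"
      proof eventually_elim
        case (elim w)
        then have "w \<in> cball z0 (R / 2)" "w \<in> D" using R by (auto simp: subset_iff)
        with h0 nonpole(1) elim(1) show False by blast
      qed
      then show False by simp
    qed
    then show thesis using that R(2) by blast
  qed
  define Z where "Z = {z\<in>D. g z = 0}"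
  have Z: "Z \<subseteq> D" by (auto simp: Z_def)
  have Zlim: "\<not> z islimpt Z" if z: "z \<in> D" for z
  proof
    assume "z islimpt Z"
    then have "g z1 = 0"
      by (rule analytic_continuation[OF g D(1,2) Z z _ _ z1(1)]) (simp add: Z_def)
    with z1(2) show False by contradiction
  qed
  then have sparse: "Z sparse_in D" using sparse_in_open[OF D(1)] by blast
  \<comment> \<open>A discrete set does not disconnect a domain. Connectedness of D - Z is what
    carries bounds from one base point to all of it.\<close>
  have S: "open (D - Z)" "connected (D - Z)" "D - Z \<noteq> {}"
    using open_diff_sparse_pts[OF D(1) sparse] sparse_imp_connected[OF _ D(2,1) sparse] z1
    by (auto simp: Z_def)
  \<comment> \<open>Hurwitz's theorem concerns nonconstant limits; a constant \<open>g\<close> is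
    nonzero because of \<open>z1\<close>.\<close>
  have Z0: "Z = {}" if hol: "\<And>n. f n holomorphic_on D"
  proof -
    have hnz: "h n z \<noteq> 0" if "z \<in> D" for n z
      using nonpole(1)[OF that] not_is_pole_holomorphic[OF D(1) that hol] by blast
    have "g z \<noteq> 0" if z: "z \<in> D" for z
    proof (cases "g constant_on D")
      case True
      then show ?thesis using z z1 unfolding constant_on_def by metis
    next
      case False
      show ?thesis
        by (rule Hurwitz_no_zeros[OF D(1,2) _ g lim False _ z]) (simp_all add: h hnz)
    qed
    then show ?thesis by (auto simp: Z_def)
  qed
  \<comment> \<open>Near a point of D - Z the reciprocals satisfy |h| > d/2 for large n. This
    excludes poles and gives |f^(k)| \<le> 2/d, so the hypothesis bounds |f^(j)|^\<alpha> by 2/(d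
    C).\<close>
  have near: "\<exists>r>0. \<exists>B. \<forall>\<^sub>F n in sequentially. f (\<sigma> n) holomorphic_on ball z r \<and>
      (\<forall>w\<in>ball z r. norm ((deriv ^^ j) (f (\<sigma> n)) w) \<le> B)" if z: "z \<in> D - Z" for z
  proof -
    define d where "d = norm (g z) / 2"
    have d: "d > 0" using z by (simp add: d_def Z_def)
    have "isCont g z"
      using g z D(1) by (metis DiffD1 continuous_on_eq_continuous_at holomorphic_on_imp_continuous_on)
    then obtain s where s: "s > 0" "\<And>w. dist w z < s \<Longrightarrow> dist (g w) (g z) < d"
      using d unfolding continuous_at_eps_delta by metis
    obtain t where t: "t > 0" "cball z t \<subseteq> D" using z D(1) open_contains_cball by (metis DiffD1)
    define r where "r = min s t"
    have r: "r > 0" "ball z r \<subseteq> cball z t" "ball z r \<subseteq> D"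
      using s t by (auto simp: r_def subset_iff)
    have gd: "norm (g w) > d" if "w \<in> ball z r" for w
    proof -
      have "dist (g w) (g z) < d" using that s(2) by (auto simp: r_def dist_commute)
      then show ?thesis using norm_triangle_sub[of "g z" "g w"] by (simp add: d_def dist_norm norm_minus_commute)
    qed
    have "d / 2 > 0" using d by simp
    from uniform_limitD[OF lim[OF compact_cball t(2)] this]
    have "\<forall>\<^sub>F n in sequentially. f (\<sigma> n) holomorphic_on ball z r \<and>
      (\<forall>w\<in>ball z r. norm ((deriv ^^ j) (f (\<sigma> n)) w) \<le> (2 / d / C) powr (1 / \<alpha>))"
    proof eventually_elim
      case (elim n)
      have hw: "norm (h (\<sigma> n) w) > d / 2" if w: "w \<in> ball z r" for w
      proof -
        have "dist (h (\<sigma> n) w) (g w) < d / 2" using elim w r(2) by auto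
        then show ?thesis
          using gd[OF w] norm_triangle_sub[of "g w" "h (\<sigma> n) w"] by (simp add: dist_norm norm_minus_commute)
      qed
      have np: "w \<in> D" "\<not> is_pole (f (\<sigma> n)) w" if w: "w \<in> ball z r" for w
        using hw[OF w] pole[of w "\<sigma> n"] w r(3) d by auto
      have "f (\<sigma> n) analytic_on ball z r"
        using nicely_meromorphic_on_imp_analytic_at[OF f] np analytic_on_analytic_at by blast
      then have "f (\<sigma> n) holomorphic_on ball z r" by (rule analytic_imp_holomorphic)
      moreover have "norm ((deriv ^^ j) (f (\<sigma> n)) w) \<le> (2 / d / C) powr (1 / \<alpha>)" if w: "w \<in> ball z r" for w
      proof -
        let ?a = "norm ((deriv ^^ j) (f (\<sigma> n)) w)"
        have "C * ?a powr \<alpha> \<le> C * (1 + ?a powr \<alpha>)"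
          using par by (intro mult_left_mono) auto
        also have "\<dots> \<le> norm (1 / h (\<sigma> n) w)"
          using ineq[OF np[OF w]] nonpole(2)[OF np[OF w]] by simp
        also have "\<dots> \<le> 1 / (d / 2)"
          unfolding norm_divide norm_one using hw[OF w] d by (intro frac_le) auto
        finally have "?a powr \<alpha> * C \<le> 2 / d" by (simp add: mult.commute)
        then have "?a powr \<alpha> \<le> 2 / d / C" using par by (simp only: pos_le_divide_eq)
        then have "(?a powr \<alpha>) powr (1 / \<alpha>) \<le> (2 / d / C) powr (1 / \<alpha>)"
          using par by (intro powr_mono2) auto
        then show ?thesis using par by (simp add: powr_powr)
      qed
      ultimately show ?case by blast
    qed
    with r(1) show ?thesis by blast
  qed
  obtain \<tau> E where \<tau>: "strict_mono (\<tau> :: nat \<Rightarrow> nat)" and E: "E \<subseteq> D - Z" "finite E" "card E \<le> j - 1"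
    and conv: "spherically_convergent_on ((f \<circ> \<sigma>) \<circ> \<tau>) (D - Z - E)"
  proof (rule spherically_convergent_subseq_of_higher_deriv_bounded[OF S, of "f \<circ> \<sigma>" j])
    show "locally_holomorphic_seq_on (D - Z) (f \<circ> \<sigma>)"
      unfolding locally_holomorphic_seq_on_def
    proof
      fix z assume "z \<in> D - Z"
      then obtain r B where r: "r > 0" "\<forall>\<^sub>F n in sequentially. f (\<sigma> n) holomorphic_on ball z r \<and>
          (\<forall>w\<in>ball z r. norm ((deriv ^^ j) (f (\<sigma> n)) w) \<le> B)"
        using near by blast
      from r(2) have "\<forall>\<^sub>F n in sequentially. (f \<circ> \<sigma>) n holomorphic_on ball z r"
        by eventually_elim simp
      with r(1) show "\<exists>r>0. \<forall>\<^sub>F n in sequentially. (f \<circ> \<sigma>) n holomorphic_on ball z r" by blast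
    qed
    show "locally_bounded_seq_on (D - Z) (\<lambda>n. (deriv ^^ j) ((f \<circ> \<sigma>) n))"
      unfolding locally_bounded_seq_on_def
    proof
      fix z assume "z \<in> D - Z"
      then obtain r B where r: "r > 0" "\<forall>\<^sub>F n in sequentially. f (\<sigma> n) holomorphic_on ball z r \<and>
          (\<forall>w\<in>ball z r. norm ((deriv ^^ j) (f (\<sigma> n)) w) \<le> B)"
        using near by blast
      from r(2) have "\<forall>\<^sub>F n in sequentially. (deriv ^^ j) ((f \<circ> \<sigma>) n) holomorphic_on ball z r \<and>
          (\<forall>w\<in>ball z r. norm ((deriv ^^ j) ((f \<circ> \<sigma>) n) w) \<le> B)"
        by eventually_elim (auto intro: holomorphic_higher_deriv)
      with r(1) show "\<exists>r>0. \<exists>B. \<forall>\<^sub>F n in sequentially. (deriv ^^ j) ((f \<circ> \<sigma>) n) holomorphic_on ball z r \<and>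
          (\<forall>w\<in>ball z r. norm ((deriv ^^ j) ((f \<circ> \<sigma>) n) w) \<le> B)" by blast
    qed
  qed blast
  show thesis
  proof (rule that[of "\<sigma> \<circ> \<tau>" Z E])
    show "strict_mono (\<sigma> \<circ> \<tau>)" using \<sigma> \<tau> by (rule strict_mono_o)
    show "spherically_convergent_on (f \<circ> (\<sigma> \<circ> \<tau>)) (D - (Z \<union> E))"
      using conv by (simp add: o_assoc Diff_Un Diff_eq Int_assoc Compl_Un)
  qed (use Z Zlim Z0 E in auto)
qed

theorem theorem1:
  fixes k j :: nat and C \<alpha> :: real
    and D :: "complex set" and F :: "(complex \<Rightarrow> complex) set"
  assumes "j < k" and "C > 0" and "\<alpha> > 1"
    and "open D" and "connected D" and "D \<noteq> {}"
    and "\<And>f. f \<in> F \<Longrightarrow> f nicely_meromorphic_on D"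
    and "\<And>f z. f \<in> F \<Longrightarrow> z \<in> D \<Longrightarrow> deriv_quotient k j \<alpha> f z \<ge> ennreal C"
  shows "quasi_normal_family_on F D \<and>
    ((\<forall>f\<in>F. f holomorphic_on D) \<longrightarrow>
       quasi_normal_family_of_order_le_on (int j - 1) F D)"
proof -
  have ineq: "C * (1 + norm ((deriv ^^ j) f z) powr \<alpha>) \<le> norm ((deriv ^^ k) f z)"
    if "f \<in> F" "z \<in> D" "\<not> is_pole f z" for f z
  proof -
    have pos: "1 + norm ((deriv ^^ j) f z) powr \<alpha> > 0"
      by (simp add: add_pos_nonneg)
    have "C \<le> norm ((deriv ^^ k) f z) / (1 + norm ((deriv ^^ j) f z) powr \<alpha>)"
      using assms(8)[OF that(1,2)] that(3) pos by (simp add: deriv_quotient_def deriv_quotient_fun_def)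
    then show ?thesis using pos by (simp add: pos_le_divide_eq)
  qed
  have sub: "\<exists>\<rho> Z E. strict_mono (\<rho> :: nat \<Rightarrow> nat) \<and> Z \<subseteq> D \<and> (\<forall>z\<in>D. \<not> z islimpt Z) \<and>
      ((\<forall>n. f n holomorphic_on D) \<longrightarrow> Z = {}) \<and> E \<subseteq> D \<and> finite E \<and> card E \<le> j - 1 \<and>
      spherically_convergent_on (f \<circ> \<rho>) (D - (Z \<union> E))" if f: "range f \<subseteq> F" for f :: "nat \<Rightarrow> complex \<Rightarrow> complex"
  proof -
    have fF: "f n \<in> F" for n using f by blast
    show ?thesis
      by (rule quasi_normal_subsequence[of D f, OF assms(4-6) assms(7)[OF fF] assms(1-3) ineq[OF fF]]) blast+
  qed
  have "quasi_normal_family_on F D"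
    unfolding quasi_normal_family_on_def
  proof (intro allI impI)
    fix f :: "nat \<Rightarrow> complex \<Rightarrow> complex" assume "range f \<subseteq> F"
    then obtain \<rho> Z E where "strict_mono \<rho>" "Z \<subseteq> D" "\<forall>z\<in>D. \<not> z islimpt Z" "E \<subseteq> D" "finite E"
      "spherically_convergent_on (f \<circ> \<rho>) (D - (Z \<union> E))"
      using sub by blast
    then show "\<exists>\<rho> E. strict_mono \<rho> \<and> E \<subseteq> D \<and> (\<forall>z\<in>D. \<not> z islimpt E) \<and> spherically_convergent_on (f \<circ> \<rho>) (D - E)"
      by (intro exI[of _ \<rho>] exI[of _ "Z \<union> E"]) (auto simp: islimpt_Un islimpt_finite)
  qed
  moreover have "quasi_normal_family_of_order_le_on (int j - 1) F D" if hol: "\<forall>f\<in>F. f holomorphic_on D"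
  proof -
    have sub': "\<exists>\<rho> E. strict_mono (\<rho> :: nat \<Rightarrow> nat) \<and> E \<subseteq> D \<and> finite E \<and> card E \<le> j - 1 \<and>
      spherically_convergent_on (f \<circ> \<rho>) (D - E)" if f: "range f \<subseteq> F" for f :: "nat \<Rightarrow> complex \<Rightarrow> complex"
    proof -
      have "\<forall>n. f n holomorphic_on D" using f hol by blast
      with sub[OF f] obtain \<rho> E where "strict_mono \<rho>" "E \<subseteq> D" "finite E" "card E \<le> j - 1"
          "spherically_convergent_on (f \<circ> \<rho>) (D - ({} \<union> E))"
        by blast
      then show ?thesis by auto
    qed
    show ?thesis
    \<comment> \<open>For j = 0 natural subtraction makes \<open>j - 1\<close> equal to 0, so
      \<open>E\<close> is empty, while the integer bound -1 selects the normal branch of the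
      definition; for j > 0 the two subtractions agree.\<close>
    proof (cases "j = 0")
      case True
      have "normal_family_on F D"
        unfolding normal_family_on_def
      proof (intro allI impI)
        fix f :: "nat \<Rightarrow> complex \<Rightarrow> complex" assume "range f \<subseteq> F"
        then obtain \<rho> E where "strict_mono \<rho>" "finite E" "card E \<le> 0" "spherically_convergent_on (f \<circ> \<rho>) (D - E)"
          using sub' True by force
        then show "\<exists>\<rho>. strict_mono \<rho> \<and> spherically_convergent_on (f \<circ> \<rho>) D"
          by auto
      qed
      then show ?thesis using True by (simp add: quasi_normal_family_of_order_le_on_def)
    next
      case False
      then have q: "int j - 1 \<noteq> -1" "int (j - 1) = int j - 1" by auto
      show ?thesis
        unfolding quasi_normal_family_of_order_le_on_def if_not_P[OF q(1)]
        unfolding q(2)[symmetric] of_nat_le_iff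
        using sub' by blast
    qed
  qed
  ultimately show ?thesis by blast
qed

end
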